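(* Let $\lambda\ge0$, let $u_{0,1},u_{0,2}$ be finite Dirac mixtures on $\mathbb{R}^d$ with supports $A_1,A_2$, and let $z_0\in\mathbb{R}^d$. Consider the differential inclusion $$\dot Z_\tau\in-\tfrac14\,\partial^C\Phi_\lambda(Z_\tau)\ \text{ for a.e. }\tau\ge0\quad(\text{if }0\le\lambda\le1),\qquad \dot Z_\tau\in-\tfrac14\,\widehat{\partial}\Phi_\lambda(Z_\tau)\ \text{ for a.e. }\tau\ge0\quad(\text{if }\lambda>1).$$ Then there exists at least one global Carathéodory solution of this inclusion with $Z_0=z_0$. Moreover, every such global solution $Z$ satisfies: 1. for every $0\le a<b<\infty$, $\ \Phi_\lambda(Z_b)-\Phi_\lambda(Z_a)=-4\int_a^b\|\dot Z_\tau\|^2\,d\tau$; in particular $\tau\mapsto\Phi_\lambda(Z_\tau)$ is nonincreasing on $[0,\infty)$; 2. there exists $x^\ast\in\mathbb{R}^d$ such that $Z_\tau\to x^\ast$ as $\tau\to\infty$; moreover $x^\ast\in\mathrm{Crit}(\Phi_\lambda)$ if $0\le\lambda\le1$, and $x^\ast\in\mathrm{Crit}_{\mathrm{out}}(\Phi_\lambda)$ if $\lambda>1$.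
   Context: A finite Dirac mixture on $\mathbb{R}^d$ is a probability measure $\sum_{k=1}^n w_k\delta_{a_k}$ with $n\ge1$, $a_k\in\mathbb{R}^d$, $w_k>0$, $\sum_k w_k=1$. Its support is $\{a_1,\dots,a_n\}$. Geometric potential: $A_i=\mathrm{supp}(u_{0,i})$, $d_i(x)=\mathrm{dist}(x,A_i)$, $\Phi_\lambda(x)=\lambda d_1(x)^2+(1-\lambda)d_2(x)^2$. Clarke subdifferential of a locally Lipschitz $f:\mathbb{R}^d\to\mathbb{R}$: $\partial^Cf(x)=\mathrm{conv}\{\lim_k\nabla f(x_k): x_k\to x,\ f \text{ differentiable at each } x_k\}$ (over all sequences for which the limit exists). Outer Clarke subdifferential of $\Phi_\lambda$: $\widehat{\partial}\Phi_\lambda(x)=\lambda\,\partial^C(d_1^2)(x)+(1-\lambda)\,\partial^C(d_2^2)(x)$ (Minkowski sum). Critical sets: $\mathrm{Crit}(\Phi_\lambda)=\{x:0\in\partial^C\Phi_\lambda(x)\}$ and $\mathrm{Crit}_{\mathrm{out}}(\Phi_\lambda)=\{x:0\in\widehat{\partial}\Phi_\lambda(x)\}$. A global Carathéodory solution of $\dot Z_\tau\in\mathcal F(Z_\tau)$, $Z_0=z_0$, for a set-valued map $\mathcal F:\mathbb{R}^d\rightrightarrows\mathbb{R}^d$, is an absolutely continuous (on bounded intervals) curve $Z:[0,\infty)\to\mathbb{R}^d$ for which there is a measurable $\xi$ with $\xi(\tau)\in\mathcal F(Z_\tau)$ for a.e. $\tau\ge0$ and $Z_\tau=z_0+\int_0^\tau\xi(s)\,ds$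 for all $\tau\ge0$. *)

theory Defs
  imports "HOL-Analysis.Analysis"
begin

text \<open>The space \<open>\<real>\<^sup>d\<close> is a type \<open>'a::euclidean_space\<close>. The points \<open>a 1, \<dots>, a n\<close> of a Dirac
  mixture need not be distinct.\<close>

definition is_dirac_mixture ::
    "'a::euclidean_space measure \<Rightarrow> nat \<Rightarrow> (nat \<Rightarrow> real) \<Rightarrow> (nat \<Rightarrow> 'a) \<Rightarrow> bool" where
  "is_dirac_mixture u n w a \<longleftrightarrow>
     n \<ge> 1 \<and> (\<forall>k\<in>{1..n}. w k > 0) \<and> (\<Sum>k=1..n. w k) = 1 \<and>
     sets u = sets borel \<and>
     (\<forall>B\<in>sets borel. emeasure u B = (\<Sum>k=1..n. ennreal (w k) * indicator B (a k)))"

definition finite_dirac_mixture :: "'a::euclidean_space measure \<Rightarrow> bool" where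
  "finite_dirac_mixture u \<longleftrightarrow> (\<exists>n w a. is_dirac_mixture u n w a)"

text \<open>The topological support of a measure; \<open>measure_support_dirac_mixture\<close> below identifies it
  with \<open>{a 1, \<dots>, a n}\<close> for a Dirac mixture.\<close>

definition measure_support :: "'a::topological_space measure \<Rightarrow> 'a set" where
  "measure_support u = {x. \<forall>U. open U \<and> x \<in> U \<longrightarrow> emeasure u U > 0}"

lemma measure_support_dirac_mixture:
  assumes "is_dirac_mixture u n w a"
  shows "measure_support u = a ` {1..n}"
proof -
  have em: "emeasure u U = (\<Sum>k=1..n. ennreal (w k) * indicator U (a k))" if "open U" for U
    using assms that by (auto simp: is_dirac_mixture_def)
  have pos: "w k > 0" if "k \<in> {1..n}" for k
    using assms that by (auto simp: is_dirac_mixture_def)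
  have iff: "emeasure u U > 0 \<longleftrightarrow> (\<exists>k\<in>{1..n}. a k \<in> U)" if "open U" for U
  proof -
    have "emeasure u U = 0 \<longleftrightarrow> (\<forall>k\<in>{1..n}. ennreal (w k) * indicator U (a k) = 0)"
      unfolding em[OF that] by (rule sum_eq_0_iff) simp
    also have "\<dots> \<longleftrightarrow> (\<forall>k\<in>{1..n}. a k \<notin> U)"
      using pos by (fastforce simp: indicator_def ennreal_eq_0_iff not_le)
    finally show ?thesis by (auto simp: zero_less_iff_neq_zero)
  qed
  show ?thesis
  proof (intro set_eqI iffI)
    fix x assume x: "x \<in> measure_support u"
    have "open (- (a ` {1..n}))"
      by (intro open_Compl finite_imp_closed) simp
    with x iff show "x \<in> a ` {1..n}"
      unfolding measure_support_def by blast
  next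
    fix x assume "x \<in> a ` {1..n}"
    then show "x \<in> measure_support u"
      unfolding measure_support_def using iff by auto
  qed
qed

definition potential ::
    "'a::euclidean_space measure \<Rightarrow> 'a measure \<Rightarrow> real \<Rightarrow> 'a \<Rightarrow> real" where
  "potential u1 u2 l x =
     l * (infdist x (measure_support u1))\<^sup>2 + (1 - l) * (infdist x (measure_support u2))\<^sup>2"

text \<open>Intended for locally Lipschitz \<open>f\<close>. The gradients \<open>G k\<close> exist only along the chosen
  sequence \<open>X\<close>, which may hit \<open>x\<close> itself.\<close>

definition clarke_subdifferential :: "('a::euclidean_space \<Rightarrow> real) \<Rightarrow> 'a \<Rightarrow> 'a set" where
  "clarke_subdifferential f x = convex hull
     {v. \<exists>X G. X \<longlonglongrightarrow> x \<and> (\<forall>k::nat. GDERIV f (X k) :> G k) \<and> G \<longlonglongrightarrow> v}"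

definition outer_subdifferential ::
    "'a::euclidean_space measure \<Rightarrow> 'a measure \<Rightarrow> real \<Rightarrow> 'a \<Rightarrow> 'a set" where
  "outer_subdifferential u1 u2 l x =
     {l *\<^sub>R v + (1 - l) *\<^sub>R w | v w.
        v \<in> clarke_subdifferential (\<lambda>y. (infdist y (measure_support u1))\<^sup>2) x \<and>
        w \<in> clarke_subdifferential (\<lambda>y. (infdist y (measure_support u2))\<^sup>2) x}"

definition Crit :: "'a::euclidean_space measure \<Rightarrow> 'a measure \<Rightarrow> real \<Rightarrow> 'a set" where
  "Crit u1 u2 l = {x. 0 \<in> clarke_subdifferential (potential u1 u2 l) x}"

definition Crit_out :: "'a::euclidean_space measure \<Rightarrow> 'a measure \<Rightarrow> real \<Rightarrow> 'a set" where
  "Crit_out u1 u2 l = {x. 0 \<in> outer_subdifferential u1 u2 l x}"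

definition abs_continuous_on_interval ::
    "real \<Rightarrow> real \<Rightarrow> (real \<Rightarrow> 'a::real_normed_vector) \<Rightarrow> bool" where
  "abs_continuous_on_interval a b Z \<longleftrightarrow>
     (\<forall>e>0. \<exists>d>0. \<forall>(n::nat) s t.
        (\<forall>i<n. a \<le> s i \<and> s i \<le> t i \<and> t i \<le> b) \<and>
        disjoint_family_on (\<lambda>i. {s i<..<t i}) {..<n} \<and>
        (\<Sum>i<n. t i - s i) < d \<longrightarrow>
        (\<Sum>i<n. norm (Z (t i) - Z (s i))) < e)"

text \<open>A curve on \<open>[0, \<infinity>)\<close> is a function on all reals whose values at negative times are
  irrelevant. Integrability of \<open>\<xi>\<close> on \<open>[0, \<tau>]\<close> is spelled out because the integral of a
  non-integrable function is \<open>0\<close> by convention.\<close>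

definition caratheodory_solution ::
    "('a::euclidean_space \<Rightarrow> 'a set) \<Rightarrow> 'a \<Rightarrow> (real \<Rightarrow> 'a) \<Rightarrow> bool" where
  "caratheodory_solution F z0 Z \<longleftrightarrow>
     (\<forall>T\<ge>0. abs_continuous_on_interval 0 T Z) \<and>
     (\<exists>\<xi>. \<xi> \<in> borel_measurable (lebesgue_on {0..}) \<and>
          (AE \<tau> in lebesgue_on {0..}. \<xi> \<tau> \<in> F (Z \<tau>)) \<and>
          (\<forall>\<tau>\<ge>0. set_integrable lebesgue {0..\<tau>} \<xi> \<and>
                  Z \<tau> = z0 + (LINT s:{0..\<tau>}|lebesgue. \<xi> s)))"

definition flow_field ::
    "'a::euclidean_space measure \<Rightarrow> 'a measure \<Rightarrow> real \<Rightarrow> 'a \<Rightarrow> 'a set" where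
  "flow_field u1 u2 l x =
     (\<lambda>v. - (1/4) *\<^sub>R v) `
       (if l \<le> 1 then clarke_subdifferential (potential u1 u2 l) x
        else outer_subdifferential u1 u2 l x)"

end

theory Submission
  imports Defs
begin

text \<open>
  Completing the square shows that \<open>\<Phi> x = \<bar>x - p\<bar>\<^sup>2 + const\<close> with \<open>p = \<lambda> a + (1 - \<lambda>) b\<close> for nearest points
  \<open>a\<close>, \<open>b\<close> of \<open>x\<close> in the two supports. Hence both set-valued fields have the form
  \<open>F x = (K x - x) / 2\<close>, where \<open>K x\<close> is a polytope of such points \<open>p\<close>, takes finitely many values, and
  satisfies \<open>K y \<subseteq> K x\<close> for \<open>y\<close> close to \<open>x\<close>.

  Existence: at each \<open>x\<close> some \<open>p \<in> K x\<close> stays selected along the segment from \<open>x\<close> towards \<open>p\<close>, so the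
  explicit solution of \<open>z' = (p - z) / 2\<close> solves the inclusion for a short time. Zorn's lemma glues
  these pieces, because a maximal uniformly Lipschitz curve defined up to a finite time extends
  beyond it; the right derivative of the glued curve serves as the measurable selection.

  Energy: a solution is locally Lipschitz and almost everywhere differentiable with derivative in
  \<open>F\<close>. Outside a countable set of times, any two points nearest to \<open>Z t\<close> have the same inner product
  with \<open>Z' t\<close>, so the chain rule holds with every choice of nearest points and gives
  \<open>(\<Phi> \<circ> Z)' = - 4 \<bar>Z'\<bar>\<^sup>2\<close>.

  Convergence: two critical points with the same nearest points coincide, so there are finitely
  many. Away from them the speed is bounded below, and every excursion of the bounded Lipschitz
  curve costs a fixed amount of energy. So the curve ends up arbitrarily close to the finite set
  of critical points, and by connectedness close to a single one of them.
\<close>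

section \<open>Differentiation of integrals\<close>

text \<open>Henstock's lemma bounds the total length of any disjoint family of intervals on which the
  average of \<open>f\<close> differs from its value at the tag by at least \<open>e\<close>; Vitali's theorem provides such
  a family covering almost all bad points.\<close>

lemma negligible_not_indefinite_integral_deriv:
  fixes f :: "real \<Rightarrow> 'a::euclidean_space"
  assumes f: "f integrable_on {a..b}"
  shows "negligible {t \<in> {a<..<b}. \<not> ((\<lambda>u. integral {a..u} f) has_vector_derivative f t) (at t)}"
proof -
  \<comment> \<open>An interval is bad for the tag \<open>t\<close> if the Henstock error on it is
    at least \<open>e\<close> times its length; \<open>S e\<close> collects the tags that have
    arbitrarily short bad intervals.\<close>
  define bad where "bad e t u v \<longleftrightarrow> a \<le> u \<and> u \<le> t \<and> t \<le> v \<and> v \<le> b \<and> u < v \<and>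
    norm ((v - u) *\<^sub>R f t - integral {u..v} f) \<ge> e * (v - u)" for e t u v
  define S where "S e = {t \<in> {a<..<b}. \<forall>d>0. \<exists>u v. bad e t u v \<and> v - u < d}" for e
  have negS: "negligible (S e)" if "e > 0" for e
    unfolding negligible_outer_le
  proof (intro allI impI)
    fix eta :: real assume "eta > 0"
    then have "e * eta > 0" using \<open>e > 0\<close> by simp
    then obtain g where g: "gauge g"
      and H: "\<And>p. p tagged_partial_division_of (cbox a b) \<Longrightarrow> g fine p \<Longrightarrow>
             sum (\<lambda>(x,k). norm (measure lborel k *\<^sub>R f x - integral k f)) p < e * eta"
      using Henstock_lemma[of f a b "e * eta"] f by (auto simp: cbox_interval)
    \<comment> \<open>Bad intervals subordinate to the gauge, indexed by tag and endpoints. Below,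
      \<open>c\<close> and \<open>r\<close> give midpoint and half-length, since the covering
      theorem speaks of closed balls.\<close>
    define I where "I = {(t,u,v). bad e t u v \<and> {u..v} \<subseteq> g t}"
    define c where "c = (\<lambda>(t::real,u::real,v::real). (u + v) / 2)"
    define r where "r = (\<lambda>(t::real,u::real,v::real). (v - u) / 2)"
    have cb: "cball (c i) (r i) = {fst (snd i)..snd (snd i)}" for i
      unfolding c_def r_def by (auto simp: cball_def dist_real_def abs_le_iff field_simps split: prod.splits)
    have rpos: "0 < r i" if "i \<in> I" for i
      using that unfolding I_def bad_def r_def by auto
    have cov: "\<exists>i. i \<in> I \<and> x \<in> cball (c i) (r i) \<and> r i < d" if xS: "x \<in> S e" and d0: "0 < d" for x d
    proof -
      obtain d' where d': "d' > 0" "ball x d' \<subseteq> g x"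
        using g by (metis gauge_def open_contains_ball)
      have ex: "\<forall>d>0. \<exists>u v. bad e x u v \<and> v - u < d" using xS unfolding S_def by simp
      obtain u v where uv: "bad e x u v" "v - u < min d d'"
        using ex[rule_format, of "min d d'"] d0 d'(1) by auto
      then have "{u..v} \<subseteq> ball x d'"
        unfolding bad_def by (auto simp: dist_real_def)
      with d' uv have "(x,u,v) \<in> I" unfolding I_def by auto
      moreover have "x \<in> cball (c (x,u,v)) (r (x,u,v))" unfolding cb using uv unfolding bad_def by auto
      moreover have "r (x,u,v) < d" using uv unfolding r_def bad_def by auto
      ultimately show ?thesis by blast
    qed
    obtain C where C: "countable C" "C \<subseteq> I"
       "pairwise (\<lambda>i j. disjnt (cball (c i) (r i)) (cball (c j) (r j))) C"
       "negligible (S e - (\<Union>i \<in> C. cball (c i) (r i)))"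
      using Vitali_covering_theorem_cballs[of I r "S e" c, OF rpos cov] by blast
    \<comment> \<open>Finitely many of the disjoint intervals form a tagged partial division. Each
      contributes at least \<open>e\<close> times its length to the Henstock sum, which is below
      \<open>e * eta\<close>.\<close>
    have fin: "measure lebesgue (\<Union>i\<in>J. cball (c i) (r i)) \<le> eta" if "finite J" "J \<subseteq> C" for J
    proof -
      define k where "k = (\<lambda>i::real\<times>real\<times>real. (fst i, {fst (snd i)..snd (snd i)}))"
      have disj: "disjnt (cball (c i) (r i)) (cball (c j) (r j))" if "i \<in> J" "j \<in> J" "i \<noteq> j" for i j
        using C(3) \<open>J \<subseteq> C\<close> that unfolding pairwise_def by blast
      have ne: "cball (c i) (r i) \<noteq> {}" if "i \<in> J" for i
        using rpos[of i] that \<open>J \<subseteq> C\<close> C(2) by force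
      have injk: "inj_on k J"
      proof (rule inj_onI, rule ccontr)
        fix i j assume ij: "i \<in> J" "j \<in> J" "k i = k j" "i \<noteq> j"
        have "snd (k i) = snd (k j)" using ij(3) by (rule arg_cong)
        then have "cball (c i) (r i) = cball (c j) (r j)" unfolding k_def cb snd_conv .
        with disj[OF ij(1,2,4)] ne[OF ij(1)] show False unfolding disjnt_def by simp
      qed
      have memI: "bad e (fst i) (fst (snd i)) (snd (snd i))" "{fst (snd i)..snd (snd i)} \<subseteq> g (fst i)"
        if "i \<in> J" for i
      proof -
        have "i \<in> I" using that \<open>J \<subseteq> C\<close> C(2) by blast
        then show "bad e (fst i) (fst (snd i)) (snd (snd i))" "{fst (snd i)..snd (snd i)} \<subseteq> g (fst i)"
          unfolding I_def case_prod_beta by simp_all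
      qed
      have memb: "fst (snd i) \<le> snd (snd i)" "e * (snd (snd i) - fst (snd i))
          \<le> norm ((snd (snd i) - fst (snd i)) *\<^sub>R f (fst i) - integral {fst (snd i)..snd (snd i)} f)"
        if "i \<in> J" for i
        using memI(1)[OF that] unfolding bad_def by auto
      have tpd: "k ` J tagged_partial_division_of (cbox a b)"
        unfolding tagged_partial_division_of_def
      proof (intro conjI allI impI)
        show "finite (k ` J)" using \<open>finite J\<close> by simp
      next
        fix x K assume "(x, K) \<in> k ` J"
        then obtain i where i: "i \<in> J" "x = fst i" "K = {fst (snd i)..snd (snd i)}" unfolding k_def by auto
        show "x \<in> K" using memI(1)[OF i(1)] unfolding i(2,3) bad_def by simp
        show "K \<subseteq> cbox a b" using memI(1)[OF i(1)] unfolding i(3) bad_def cbox_interval by simp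
        show "\<exists>a b. K = cbox a b" unfolding i(3) cbox_interval by blast
      next
        fix x K y L assume xy: "(x, K) \<in> k ` J \<and> (y, L) \<in> k ` J \<and> (x, K) \<noteq> (y, L)"
        obtain i where i: "i \<in> J" "(x,K) = k i" using xy by blast
        obtain j where j: "j \<in> J" "(y,L) = k j" using xy by blast
        have "i \<noteq> j" using xy unfolding i(2) j(2) by auto
        note ij = i(1) j(1) i(2) j(2) this
        then have "K = cball (c i) (r i)" "L = cball (c j) (r j)" unfolding k_def cb by auto
        then have "K \<inter> L = {}" using disj[OF ij(1,2,5)] unfolding disjnt_def by simp
        then show "interior K \<inter> interior L = {}" using interior_subset by blast
      qed
      have fine: "g fine k ` J"
        using memI unfolding fine_def k_def by auto
      have "measure lebesgue (\<Union>i\<in>J. cball (c i) (r i)) \<le> (\<Sum>i\<in>J. measure lebesgue (cball (c i) (r i)))"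
        using \<open>finite J\<close> by (intro measure_UNION_le) auto
      also have "\<dots> = (\<Sum>i\<in>J. snd (snd i) - fst (snd i))"
        unfolding cb using memb(1) by (intro sum.cong) simp_all
      finally have "e * measure lebesgue (\<Union>i\<in>J. cball (c i) (r i)) \<le> (\<Sum>i\<in>J. e * (snd (snd i) - fst (snd i)))"
        using \<open>e > 0\<close> by (simp add: sum_distrib_left[symmetric])
      also have "\<dots> \<le> (\<Sum>i\<in>J. (\<lambda>(x,k). norm (measure lborel k *\<^sub>R f x - integral k f)) (k i))"
        using memb by (intro sum_mono) (simp add: k_def)
      also have "\<dots> = sum (\<lambda>(x,k). norm (measure lborel k *\<^sub>R f x - integral k f)) (k ` J)"
        by (rule sum.reindex[OF injk, symmetric, unfolded o_def])
      also have "\<dots> < e * eta" by (rule H[OF tpd fine])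
      finally show ?thesis using \<open>e > 0\<close> by simp
    qed
    define D where "D = (\<lambda>i. cball (c i) (r i)) ` C"
    have "\<Union>D \<in> lmeasurable \<and> measure lebesgue (\<Union>D) \<le> eta"
    proof (cases "C = {}")
      case True then show ?thesis using \<open>eta > 0\<close> by (auto simp: D_def)
    next
      case False
      have eq: "\<Union>D = (\<Union>n. cball (c (from_nat_into C n)) (r (from_nat_into C n)))"
      proof -
        have "(\<lambda>i. cball (c i) (r i)) ` range (from_nat_into C) = D"
          unfolding D_def range_from_nat_into[OF False C(1)] ..
        then show ?thesis by (simp only: image_image)
      qed
      \<comment> \<open>The balls are enumerated, possibly with repetitions, so that the bound on
        finite unions passes to the countable union.\<close>
      define B where "B n = cball (c (from_nat_into C n)) (r (from_nat_into C n))" for n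
      have Bm: "B n \<in> lmeasurable" for n unfolding B_def by simp
      have b: "measure lebesgue (\<Union>n\<le>m. B n) \<le> eta" for m
      proof -
        have "from_nat_into C ` {..m} \<subseteq> C" using from_nat_into[OF False] by blast
        then have "measure lebesgue (\<Union>i\<in>from_nat_into C ` {..m}. cball (c i) (r i)) \<le> eta"
          by (intro fin) auto
        then show ?thesis unfolding B_def image_image .
      qed
      have "\<Union>D = (\<Union>n. B n)" using eq unfolding B_def .
      then show ?thesis
        using fmeasurable_countable_Union[of B lebesgue eta, OF Bm b] measure_countable_Union_le[of B lebesgue eta, OF Bm b] by simp
    qed
    then have D: "\<Union>D \<in> lmeasurable" "measure lebesgue (\<Union>D) \<le> eta" by auto
    have N: "negligible (S e - \<Union>D)" using C(4) unfolding D_def by simp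
    have "measure lebesgue (\<Union>D \<union> (S e - \<Union>D)) \<le> eta"
      using measure_Un_le[of "\<Union>D" lebesgue "S e - \<Union>D"] D N negligible_imp_measure0[OF N]
        negligible_imp_sets[OF N] fmeasurableD[OF D(1)] by auto
    moreover have "\<Union>D \<union> (S e - \<Union>D) \<in> lmeasurable"
      using D(1) negligible_imp_measurable[OF N] by (rule fmeasurable.Un)
    ultimately show "\<exists>T. S e \<subseteq> T \<and> T \<in> lmeasurable \<and> measure lebesgue T \<le> eta"
      by (intro exI[of _ "\<Union>D \<union> (S e - \<Union>D)"] conjI) simp_all
  qed
  \<comment> \<open>Off this union, for each \<open>n\<close> every sufficiently short interval with
    endpoint \<open>t\<close> has error less than \<open>1 / Suc n\<close> times its length; that is
    differentiability from both sides.\<close>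
  have "negligible (\<Union>n::nat. S (1 / Suc n))"
    by (intro negligible_countable_Union) (auto intro!: negS)
  moreover have "((\<lambda>u. integral {a..u} f) has_vector_derivative f t) (at t)"
    if t: "t \<in> {a<..<b}" and nS: "t \<notin> (\<Union>n::nat. S (1 / Suc n))" for t
    unfolding has_vector_derivative_def has_derivative_at_alt
  proof (intro conjI allI impI)
    show "bounded_linear (\<lambda>x. x *\<^sub>R f t)" by (rule bounded_linear_scaleR_left)
    fix e :: real assume "e > 0"
    then obtain n :: nat where n: "1 / Suc n < e" using nat_approx_posE by blast
    have "t \<notin> S (1 / Suc n)" using nS by (simp only: UN_iff) simp
    then have "\<not> (\<forall>d>0. \<exists>u v. bad (1 / Suc n) t u v \<and> v - u < d)"
      using t unfolding S_def mem_Collect_eq by (simp only: simp_thms)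
    then obtain d where d: "d > 0" and nb0: "\<not> (\<exists>u v. bad (1 / Suc n) t u v \<and> v - u < d)"
      by (elim not_all[THEN iffD1, elim_format] exE) (simp only: not_imp, elim conjE)
    have nb: "\<not> v - u < d" if "bad (1 / Suc n) t u v" for u v
      using nb0 that by meson
    have I: "f integrable_on {u..v}" if "a \<le> u" "v \<le> b" for u v
      using integrable_subinterval_real[OF f, of u v] that by auto
    have split: "integral {a..v} f - integral {a..u} f = integral {u..v} f" if "a \<le> u" "u \<le> v" "v \<le> b" for u v
      using Henstock_Kurzweil_Integration.integral_combine[of a u v f, OF _ _ I] that by (simp add: algebra_simps)
    show "\<exists>d>0. \<forall>y. norm (y - t) < d \<longrightarrow>
      norm (integral {a..y} f - integral {a..t} f - (y - t) *\<^sub>R f t) \<le> e * norm (y - t)"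
    proof (intro exI[of _ "min d (min (t - a) (b - t))"] conjI allI impI)
      show "0 < min d (min (t - a) (b - t))" using d t by auto
      fix y assume y: "norm (y - t) < min d (min (t - a) (b - t))"
      consider "y = t" | "y < t" | "y > t" by linarith
      then show "norm (integral {a..y} f - integral {a..t} f - (y - t) *\<^sub>R f t) \<le> e * norm (y - t)"
      proof cases
        case 1 then show ?thesis by simp
      next
        case 2
        then have "\<not> bad (1 / Suc n) t y t" using nb[of y t] y by auto
        then have "norm ((t - y) *\<^sub>R f t - integral {y..t} f) < 1 / Suc n * (t - y)"
          unfolding bad_def using 2 t y by auto
        also have "\<dots> \<le> e * (t - y)" using n 2 by (intro mult_right_mono) auto
        also have "(t - y) *\<^sub>R f t - integral {y..t} f = integral {a..y} f - integral {a..t} f - (y - t) *\<^sub>R f t"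
          using split[of y t] 2 t y by (simp add: algebra_simps)
        finally show ?thesis using 2 by simp
      next
        case 3
        then have "\<not> bad (1 / Suc n) t t y" using nb[of t y] y by auto
        then have "norm ((y - t) *\<^sub>R f t - integral {t..y} f) < 1 / Suc n * (y - t)"
          unfolding bad_def using 3 t y by auto
        also have "\<dots> \<le> e * (y - t)" using n 3 by (intro mult_right_mono) auto
        also have "norm ((y - t) *\<^sub>R f t - integral {t..y} f) = norm (integral {a..y} f - integral {a..t} f - (y - t) *\<^sub>R f t)"
          using split[of t y] 3 t y by (simp add: norm_minus_commute)
        finally show ?thesis using 3 by simp
      qed
    qed
  qed
  then have "{t \<in> {a<..<b}. \<not> ((\<lambda>u. integral {a..u} f) has_vector_derivative f t) (at t)} \<subseteq> (\<Union>n::nat. S (1 / Suc n))"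
    by blast
  ultimately show ?thesis by (rule negligible_subset)
qed

text \<open>Forward difference quotients are bounded by \<open>L\<close> and converge to
  \<open>g\<close> off \<open>N\<close>, so their integrals converge to that of \<open>g\<close>;
  these integrals are also differences of short averages of \<open>f\<close> at \<open>b\<close> and
  at \<open>a\<close>. The interval reaches \<open>b + 1\<close> to leave room for the forward
  shift.\<close>

lemma lipschitz_has_integral_right_derivative:
  fixes f :: "real \<Rightarrow> 'a::euclidean_space"
  assumes lip: "L-lipschitz_on {a..b + 1} f" and ab: "a \<le> b" and N: "negligible N"
    and der: "\<And>t. t \<in> {a..b} - N \<Longrightarrow> (f has_vector_derivative g t) (at_right t)"
  shows "(g has_integral (f b - f a)) {a..b}"
proof -
  have cont: "continuous_on {a..b+1} f" using lip by (rule lipschitz_on_continuous_on)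
  have L: "norm (f x - f y) \<le> L * \<bar>x - y\<bar>" if "x \<in> {a..b+1}" "y \<in> {a..b+1}" for x y
    using lipschitz_onD[OF lip that] by (simp add: dist_norm)
  have L0: "L \<ge> 0" using lip by (simp add: lipschitz_on_def)
  define h where "h n = 1 / (real n + 2)" for n :: nat
  have h: "0 < h n" "h n \<le> 1" for n unfolding h_def by auto
  have hnz: "h n \<noteq> 0" "0 \<le> h n" for n using h(1)[of n] by auto
  have h0: "h \<longlonglongrightarrow> 0" unfolding h_def by real_asymp
  define D where "D n t = (1 / h n) *\<^sub>R (f (t + h n) - f t)" for n t
  have int: "f integrable_on {u..v}" if "a \<le> u" "v \<le> b + 1" for u v
    by (rule integrable_continuous_real) (rule continuous_on_subset[OF cont], use that in auto)
  have int_shift: "((\<lambda>t. f (t + h n)) has_integral integral {a + h n..b + h n} f) {a..b}" for n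
  proof -
    have "(f has_integral integral {a + h n..b + h n} f) {a + h n..b + h n}"
      by (rule integrable_integral, rule int) (use h hnz in auto)
    then have "((\<lambda>t. f (1 *\<^sub>R t + h n)) has_integral (1 / (\<bar>1\<bar> ^ DIM(real))) *\<^sub>R integral {a + h n..b + h n} f)
      ((\<lambda>x. (1 / 1) *\<^sub>R x + - ((1 / 1) *\<^sub>R h n)) ` cbox (a + h n) (b + h n))"
      by (intro has_integral_affinity) (auto simp: cbox_interval)
    moreover have "(\<lambda>x. x + - h n) ` {a + h n..b + h n} = {a..b}"
      by (auto simp: image_iff intro!: bexI[of _ "_ + h n"])
    ultimately show ?thesis by (simp add: cbox_interval)
  qed
  have intD: "(D n has_integral (1 / h n) *\<^sub>R (integral {b..b + h n} f - integral {a..a + h n} f)) {a..b}" for n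
  proof -
    \<comment> \<open>Splitting \<open>{a..b + h n}\<close> at \<open>b\<close> and at
      \<open>a + h n\<close> leaves only the two short end intervals.\<close>
    have "integral {a + h n..b + h n} f - integral {a..b} f = integral {b..b + h n} f - integral {a..a + h n} f"
      using Henstock_Kurzweil_Integration.integral_combine[of a b "b + h n" f]
        Henstock_Kurzweil_Integration.integral_combine[of a "a + h n" "b + h n" f]
        int[of a "b + h n"] h[of n] ab by (simp add: algebra_simps)
    moreover have "(D n has_integral (1 / h n) *\<^sub>R (integral {a + h n..b + h n} f - integral {a..b} f)) {a..b}"
      unfolding D_def using int_shift[of n] integrable_integral[OF int[of a b]]
      by (intro has_integral_cmul has_integral_diff) auto
    ultimately show ?thesis by simp
  qed
  have near: "norm (integral {c..c + h n} f - h n *\<^sub>R f c) \<le> h n * (L * h n)" if "c \<in> {a..b}" for c n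
  proof -
    have I: "(f has_integral integral {c..c + h n} f) {c..c + h n}"
      by (rule integrable_integral, rule int) (use h[of n] that in auto)
    have J: "((\<lambda>t. f c) has_integral (h n *\<^sub>R f c)) {c..c + h n}"
      using has_integral_const_real[of "f c" c "c + h n"] h[of n] by simp
    have "((\<lambda>t. f t - f c) has_integral (integral {c..c + h n} f - h n *\<^sub>R f c)) {c..c + h n}"
      by (rule has_integral_diff[OF I J])
    moreover have "norm (f t - f c) \<le> L * h n" if t: "t \<in> {c..c + h n}" for t
    proof -
      have "norm (f t - f c) \<le> L * \<bar>t - c\<bar>" using L[of t c] t \<open>c \<in> {a..b}\<close> h[of n] by auto
      also have "\<dots> \<le> L * h n" using t L0 by (intro mult_left_mono) auto
      finally show ?thesis .
    qed
    ultimately have "norm (integral {c..c + h n} f - h n *\<^sub>R f c) \<le> (L * h n) * measure lborel (cbox c (c + h n))"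
      using L0 h[of n] by (intro has_integral_bound[of "L * h n" "\<lambda>t. f t - f c"]) (auto simp: cbox_interval)
    then show ?thesis using h[of n] by (simp add: mult.commute)
  qed
  have lim1: "(\<lambda>n. (1 / h n) *\<^sub>R integral {c..c + h n} f) \<longlonglongrightarrow> f c" if "c \<in> {a..b}" for c
  proof (rule LIM_zero_cancel, rule tendsto_norm_zero_cancel, rule tendsto_sandwich[of "\<lambda>_. 0" _ _ "\<lambda>n. L * h n"])
    show "\<forall>\<^sub>F n in sequentially. norm ((1 / h n) *\<^sub>R integral {c..c + h n} f - f c) \<le> L * h n"
    proof (intro always_eventually allI)
      fix n
      have "(1 / h n) *\<^sub>R integral {c..c + h n} f - f c = (1 / h n) *\<^sub>R (integral {c..c + h n} f - h n *\<^sub>R f c)"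
        using h[of n] by (simp add: scaleR_diff_right)
      then show "norm ((1 / h n) *\<^sub>R integral {c..c + h n} f - f c) \<le> L * h n"
        using near[OF that, of n] h[of n] by (simp add: divide_le_eq mult_ac)
    qed
    show "(\<lambda>n. L * h n) \<longlonglongrightarrow> 0" using tendsto_mult_right[OF h0, of L] by (simp add: mult.commute)
  qed auto
  \<comment> \<open>Both functions are set to \<open>0\<close> on \<open>N\<close>, so that the
    bound and the convergence hold at every point of the interval.\<close>
  define D' where "D' n t = (if t \<in> N then 0 else D n t)" for n t
  define g' where "g' t = (if t \<in> N then 0 else g t)" for t
  have spike: "(D' n has_integral (1 / h n) *\<^sub>R (integral {b..b + h n} f - integral {a..a + h n} f)) {a..b}" for n
    by (rule has_integral_spike[OF N _ intD]) (auto simp: D'_def)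
  have bd: "norm (D' n t) \<le> L" if "t \<in> {a..b}" for n t
  proof -
    have "norm (f (t + h n) - f t) \<le> L * h n" using L[of "t + h n" t] that h[of n] by auto
    then show ?thesis using h[of n] L0 by (simp add: D'_def D_def divide_le_eq)
  qed
  have conv: "(\<lambda>n. D' n t) \<longlonglongrightarrow> g' t" if "t \<in> {a..b}" for t
  proof (cases "t \<in> N")
    case True then show ?thesis by (simp add: D'_def g'_def)
  next
    case False
    have "((\<lambda>y. (1 / (y - t)) *\<^sub>R (f y - f t)) \<longlongrightarrow> g t) (at_right t)"
    proof -
      have "((\<lambda>y. ((f y - f t) - (y - t) *\<^sub>R g t) /\<^sub>R norm (y - t)) \<longlongrightarrow> 0) (at_right t)"
        using der[of t] that False
        unfolding has_vector_derivative_def has_derivative_def by (auto simp: Lim_ident_at)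
      then have "((\<lambda>y. ((f y - f t) - (y - t) *\<^sub>R g t) /\<^sub>R norm (y - t) + g t) \<longlongrightarrow> 0 + g t) (at_right t)"
        by (intro tendsto_intros)
      moreover have "\<forall>\<^sub>F y in at_right t. (f y - f t - (y - t) *\<^sub>R g t) /\<^sub>R norm (y - t) + g t = (1 / (y - t)) *\<^sub>R (f y - f t)"
          unfolding eventually_at_right_field
          by (intro exI[of _ "t + 1"]) (auto simp: scaleR_diff_right divide_inverse)
      ultimately show ?thesis using Lim_transform_eventually by fastforce
    qed
    moreover have "filterlim (\<lambda>n. t + h n) (at_right t) sequentially"
      unfolding filterlim_at using h hnz h0 by (auto intro!: always_eventually tendsto_eq_intros)
    ultimately have "(\<lambda>n. (1 / (t + h n - t)) *\<^sub>R (f (t + h n) - f t)) \<longlonglongrightarrow> g t"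
      by (rule filterlim_compose)
    then show ?thesis using False by (simp add: D'_def g'_def D_def)
  qed
  have dc: "g' integrable_on {a..b}" "(\<lambda>n. integral {a..b} (D' n)) \<longlonglongrightarrow> integral {a..b} g'"
    using dominated_convergence[of D' "{a..b}" "\<lambda>_. L" g'] spike bd conv by (auto simp: has_integral_iff)
  have "(\<lambda>n. (1 / h n) *\<^sub>R integral {b..b + h n} f - (1 / h n) *\<^sub>R integral {a..a + h n} f) \<longlonglongrightarrow> f b - f a"
    by (intro tendsto_diff lim1) (use ab in auto)
  moreover have "integral {a..b} (D' n) = (1 / h n) *\<^sub>R integral {b..b + h n} f - (1 / h n) *\<^sub>R integral {a..a + h n} f" for n
    using integral_unique[OF spike[of n]] by (simp add: scaleR_diff_right)
  ultimately have "integral {a..b} g' = f b - f a"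
    using dc(2) by (simp add: LIMSEQ_unique)
  then have "(g' has_integral (f b - f a)) {a..b}" using dc(1) integrable_integral by fastforce
  then show ?thesis by (rule has_integral_spike[OF N, rotated]) (simp add: g'_def)
qed

section \<open>Nearest points in a finite set\<close>

definition near :: "'a::metric_space set \<Rightarrow> 'a \<Rightarrow> 'a set" where
  "near A x = {a \<in> A. dist x a = infdist x A}"

lemma near_subset: "near A x \<subseteq> A"
  by (auto simp: near_def)

lemma finite_near: "finite A \<Longrightarrow> finite (near A x)"
  using finite_subset near_subset by blast

lemma near_iff:
  assumes "finite A"
  shows "a \<in> near A x \<longleftrightarrow> a \<in> A \<and> (\<forall>b\<in>A. dist x a \<le> dist x b)"
proof (cases "A = {}")
  case False
  then have inf: "infdist x A = Min (dist x ` A)"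
    using assms by (simp add: infdist_def cInf_eq_Min)
  show ?thesis unfolding near_def inf using assms False
    by (auto simp: Min_eq_iff eq_commute[of "dist x a"]) 
qed (simp add: near_def)

lemma near_nonempty:
  assumes "finite A" "A \<noteq> {}"
  shows "near A x \<noteq> {}"
proof -
  obtain a where "a \<in> A" "\<And>b. b \<in> A \<Longrightarrow> dist x a \<le> dist x b"
    using ex_min_if_finite[of "dist x ` A"] assms
    by (metis (mono_tags, lifting) finite_imageI image_iff image_is_empty not_less)
  then show ?thesis using near_iff[OF assms(1)] by blast
qed

lemma closed_near:
  assumes "finite A"
  shows "closed {x. a \<in> near A x}"
proof -
  have "{x. a \<in> near A x} = {x. a \<in> A} \<inter> (\<Inter>b\<in>A. {x. dist x a \<le> dist x b})"
    using near_iff[OF assms] by auto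
  moreover have "closed {x. dist x a \<le> dist x b}" for b
    by (intro closed_Collect_le continuous_intros)
  ultimately show ?thesis by auto
qed

text \<open>The finitely many closed sets that miss \<open>x\<close> also miss a neighbourhood of
  it. This is the source of upper semicontinuity, both for nearest points and for the gradient
  regions of the inner flow.\<close>

lemma finite_closed_family_locally_subset:
  fixes C :: "'b \<Rightarrow> 'a::metric_space set"
  assumes "finite S" and "\<And>p. closed (C p)"
  shows "\<exists>e>0. \<forall>y\<in>ball x e. {p \<in> S. y \<in> C p} \<subseteq> {p \<in> S. x \<in> C p}"
proof -
  define V where "V = - (\<Union>p\<in>{p \<in> S. x \<notin> C p}. C p)"
  have "open V" unfolding V_def using assms by (intro open_Compl closed_UN) auto
  moreover have "x \<in> V" unfolding V_def by simp
  ultimately obtain e where "e > 0" "ball x e \<subseteq> V" by (meson open_contains_ball)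
  then show ?thesis unfolding V_def by (intro exI[of _ e]) blast
qed

lemma near_locally_subset:
  assumes "finite A"
  shows "\<exists>e>0. \<forall>y\<in>ball x e. near A y \<subseteq> near A x"
proof -
  have eq: "near A z = {a \<in> A. z \<in> {x. a \<in> near A x}}" for z using near_subset by blast
  then show ?thesis
    using finite_closed_family_locally_subset[of A "\<lambda>a. {x. a \<in> near A x}" x] closed_near[OF assms] assms
    unfolding eq[symmetric] by blast
qed

section \<open>Squared distances along a curve\<close>

lemma countable_isolated_points:
  fixes S :: "real set"
  shows "countable {t \<in> S. \<not> t islimpt S}"
proof -
  \<comment> \<open>Each isolated point is singled out by an interval with rational endpoints, so
    choosing one such interval per point is injective.\<close>
  have ex: "\<exists>q::rat \<times> rat. real_of_rat (fst q) < t \<and> t < real_of_rat (snd q) \<and> S \<inter> {real_of_rat (fst q)<..<real_of_rat (snd q)} = {t}"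
    if tS: "t \<in> S" and nl: "\<not> t islimpt S" for t
  proof -
    obtain e where e: "e > 0" "\<And>s. s \<in> S \<Longrightarrow> s \<noteq> t \<Longrightarrow> dist s t \<ge> e"
      using nl unfolding islimpt_approachable by (meson not_less)
    obtain q where q: "t - e < real_of_rat q" "real_of_rat q < t" using of_rat_dense[of "t - e" t] e by auto
    obtain r where r: "t < real_of_rat r" "real_of_rat r < t + e" using of_rat_dense[of t "t + e"] e by auto
    have u: "s = t" if "s \<in> S" "real_of_rat q < s" "s < real_of_rat r" for s
      using e(2)[of s] that q r by (force simp: dist_real_def)
    have "S \<inter> {real_of_rat q<..<real_of_rat r} = {t}"
    proof (intro equalityI subsetI)
      fix s assume "s \<in> S \<inter> {real_of_rat q<..<real_of_rat r}"
      then show "s \<in> {t}" using u[of s] by simp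
    next
      fix s assume "s \<in> {t}"
      then show "s \<in> S \<inter> {real_of_rat q<..<real_of_rat r}" using tS q(2) r(1) by simp
    qed
    with q(2) r(1) show ?thesis by (intro exI[of _ "(q,r)"]) simp
  qed
  define f where "f t = (SOME q::rat \<times> rat. real_of_rat (fst q) < t \<and> t < real_of_rat (snd q) \<and>
     S \<inter> {real_of_rat (fst q)<..<real_of_rat (snd q)} = {t})" for t
  have f: "S \<inter> {real_of_rat (fst (f t))<..<real_of_rat (snd (f t))} = {t}" if "t \<in> {t \<in> S. \<not> t islimpt S}" for t
    using someI_ex[OF ex[of t]] that unfolding f_def by blast
  have "inj_on f {t \<in> S. \<not> t islimpt S}"
  proof (rule inj_onI)
    fix s t assume st: "s \<in> {t \<in> S. \<not> t islimpt S}" "t \<in> {t \<in> S. \<not> t islimpt S}" "f s = f t"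
    have "{s} = {t}" using f[OF st(1)] f[OF st(2)] unfolding st(3) by (rule trans[OF sym])
    then show "s = t" by simp
  qed
  then show ?thesis by (rule countableI')
qed

definition coincidence :: "(real \<Rightarrow> 'a::metric_space) \<Rightarrow> 'a \<Rightarrow> 'a \<Rightarrow> real set" where
  "coincidence Z a b = {t. dist (Z t) a = dist (Z t) b}"

text \<open>Exceptional times of the chain rule, at which two points may be equidistant for an
  instant only. For \<open>a = b\<close> there are none.\<close>

definition isolated_coincidences :: "(real \<Rightarrow> 'a::metric_space) \<Rightarrow> 'a set \<Rightarrow> real set" where
  "isolated_coincidences Z A =
     (\<Union>a\<in>A. \<Union>b\<in>A. {t \<in> coincidence Z a b. \<not> t islimpt coincidence Z a b})"

lemma countable_isolated_coincidences: "finite A \<Longrightarrow> countable (isolated_coincidences Z A)"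
  unfolding isolated_coincidences_def
  by (intro countable_UN countable_isolated_points) (auto intro: countable_finite)

lemma dist_sq_has_derivative:
  fixes Z :: "real \<Rightarrow> 'a::euclidean_space"
  assumes "(Z has_vector_derivative v) (at t within S)"
  shows "((\<lambda>s. (dist (Z s) a)\<^sup>2) has_vector_derivative 2 * ((Z t - a) \<bullet> v)) (at t within S)"
proof -
  have "((\<lambda>s. (Z s - a) \<bullet> (Z s - a)) has_derivative (\<lambda>h. (Z t - a) \<bullet> (h *\<^sub>R v) + (h *\<^sub>R v) \<bullet> (Z t - a))) (at t within S)"
    using assms unfolding has_vector_derivative_def
    by (intro has_derivative_inner derivative_eq_intros) auto
  then show ?thesis unfolding has_vector_derivative_def dist_norm power2_norm_eq_inner
    by (rule has_derivative_eq_rhs) (auto simp: inner_commute algebra_simps)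
qed

text \<open>The squared distances to \<open>a\<close> and \<open>b\<close> agree on a set
  accumulating at \<open>t\<close>, so their derivatives along that set,
  \<open>2 * ((Z t - a) \<bullet> v)\<close> and \<open>2 * ((Z t - b) \<bullet> v)\<close>,
  coincide.\<close>

lemma orthogonal_at_coincidence:
  fixes Z :: "real \<Rightarrow> 'a::euclidean_space"
  assumes fin: "finite A" and d: "(Z has_vector_derivative v) (at t)" and t: "t \<notin> isolated_coincidences Z A"
    and ab: "a \<in> near A (Z t)" "b \<in> near A (Z t)"
  shows "a \<bullet> v = b \<bullet> v"
proof -
  let ?S = "coincidence Z a b"
  have tS: "t \<in> ?S" using ab unfolding near_def coincidence_def by simp
  then have "t islimpt ?S" using t ab near_subset unfolding isolated_coincidences_def by blast
  then have nb: "at t within ?S \<noteq> bot" by (simp add: trivial_limit_within)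
  have d': "(Z has_vector_derivative v) (at t within ?S)"
    using d has_vector_derivative_at_within by blast
  have "((\<lambda>s. (dist (Z s) a)\<^sup>2) has_vector_derivative 2 * ((Z t - b) \<bullet> v)) (at t within ?S)"
    using dist_sq_has_derivative[OF d', of b]
    by (rule has_vector_derivative_transform[OF tS, rotated]) (simp add: coincidence_def)
  from vector_derivative_unique_within[OF nb dist_sq_has_derivative[OF d', of a] this]
  show ?thesis by (simp add: inner_diff_left)
qed

text \<open>Near \<open>t\<close> the distance is attained at points of \<open>near A (Z t)\<close>,
  perhaps a different one at each time, but all of them give the same derivative. Allowing
  \<open>p\<close> in the whole hull makes it possible to insert later the very points that define
  the velocity.\<close>

lemma infdist_sq_has_derivative:
  fixes Z :: "real \<Rightarrow> 'a::euclidean_space"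
  assumes fin: "finite A" and d: "(Z has_vector_derivative v) (at t)" and t: "t \<notin> isolated_coincidences Z A"
    and p: "p \<in> convex hull near A (Z t)"
  shows "((\<lambda>s. (infdist (Z s) A)\<^sup>2) has_vector_derivative 2 * ((Z t - p) \<bullet> v)) (at t)"
proof -
  define c where "c = 2 * ((Z t - p) \<bullet> v)"
  obtain a0 where a0: "a0 \<in> near A (Z t)" using p by fastforce
  \<comment> \<open>All nearest points lie in one level set of the inner product with
    \<open>v\<close>; it is convex and so contains their hull.\<close>
  have "near A (Z t) \<subseteq> {x. v \<bullet> x = a0 \<bullet> v}"
    using orthogonal_at_coincidence[OF fin d t _ a0] by (auto simp: inner_commute)
  then have "convex hull near A (Z t) \<subseteq> {x. v \<bullet> x = a0 \<bullet> v}"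
    by (intro hull_minimal convex_hyperplane)
  then have pa: "p \<bullet> v = b \<bullet> v" if "b \<in> near A (Z t)" for b
    using orthogonal_at_coincidence[OF fin d t a0 that] p by (auto simp: inner_commute)
  have der: "((\<lambda>s. ((dist (Z s) b)\<^sup>2 - (dist (Z t) b)\<^sup>2) / (s - t)) \<longlongrightarrow> c) (at t)" if "b \<in> near A (Z t)" for b
    using dist_sq_has_derivative[OF d, of b] pa[OF that]
    unfolding c_def has_real_derivative_iff_has_vector_derivative[symmetric] has_field_derivative_iff
    by (simp add: inner_diff_left)
  obtain e where e: "e > 0" "\<And>y. y \<in> ball (Z t) e \<Longrightarrow> near A y \<subseteq> near A (Z t)"
    using near_locally_subset[OF fin] by blast
  have "isCont Z t" using d by (rule has_vector_derivative_continuous)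
  then have evb: "\<forall>\<^sub>F s in at t. Z s \<in> ball (Z t) e"
    using e(1) unfolding isCont_def tendsto_iff by (simp add: dist_commute)
  have "((\<lambda>s. ((infdist (Z s) A)\<^sup>2 - (infdist (Z t) A)\<^sup>2) / (s - t)) \<longlongrightarrow> c) (at t)"
  proof (rule tendstoI)
    fix \<epsilon> :: real assume "\<epsilon> > 0"
    \<comment> \<open>Finitely many difference quotients are close to \<open>c\<close>
      simultaneously, so it does not matter which nearest point is active at time
      \<open>s\<close>.\<close>
    have "\<forall>\<^sub>F s in at t. \<forall>b\<in>near A (Z t). dist (((dist (Z s) b)\<^sup>2 - (dist (Z t) b)\<^sup>2) / (s - t)) c < \<epsilon>"
      using finite_near[OF fin] der \<open>\<epsilon> > 0\<close> by (intro eventually_ball_finite ballI tendstoD)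
    with evb show "\<forall>\<^sub>F s in at t. dist (((infdist (Z s) A)\<^sup>2 - (infdist (Z t) A)\<^sup>2) / (s - t)) c < \<epsilon>"
    proof eventually_elim
      case (elim s)
      have "A \<noteq> {}" using a0 near_subset by blast
      then obtain b where b: "b \<in> near A (Z s)" using near_nonempty[OF fin] by blast
      then have b': "b \<in> near A (Z t)" using e(2)[OF elim(1)] by blast
      have "infdist (Z s) A = dist (Z s) b" "infdist (Z t) A = dist (Z t) b"
        using b b' unfolding near_def by auto
      then show ?case using elim(2) b' by simp
    qed
  qed
  then show ?thesis
    unfolding c_def has_real_derivative_iff_has_vector_derivative[symmetric] has_field_derivative_iff .
qed

section \<open>Convergence of solutions\<close>

text \<open>Open balls with half the minimal separation of \<open>C\<close> as radius are disjoint,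
  so the connected tail of the curve stays in a single one; smaller radii then force convergence to
  its centre.\<close>

lemma converges_if_near_finite_set:
  fixes Z :: "real \<Rightarrow> 'a::metric_space"
  assumes fin: "finite C" and cont: "continuous_on {0..} Z"
    and nr: "\<And>r. r > 0 \<Longrightarrow> \<exists>T\<ge>0. \<forall>t\<ge>T. \<exists>c\<in>C. dist (Z t) c < r"
  shows "\<exists>c\<in>C. (Z \<longlongrightarrow> c) at_top"
proof -
  obtain r0 where r0: "r0 > 0" "\<And>c d. c \<in> C \<Longrightarrow> d \<in> C \<Longrightarrow> c \<noteq> d \<Longrightarrow> r0 \<le> dist c d"
  proof -
    have "\<exists>r>0. \<forall>c\<in>C. \<forall>d\<in>C. c \<noteq> d \<longrightarrow> r \<le> dist c d"
    proof -
      have "\<exists>d>0. \<forall>x\<in>C. x \<noteq> c \<longrightarrow> d \<le> dist c x" for c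
        using finite_set_avoid[OF fin, of c] by auto
      then obtain f where f: "\<And>c. f c > 0" "\<And>c x. x \<in> C \<Longrightarrow> x \<noteq> c \<Longrightarrow> f c \<le> dist c x" by metis
      show ?thesis
      proof (intro exI[of _ "Min (insert 1 (f ` C))"] conjI ballI impI)
        show "0 < Min (insert 1 (f ` C))" using fin f(1) by (subst Min_gr_iff) auto
        fix c d assume "c \<in> C" "d \<in> C" "c \<noteq> d"
        then have "Min (insert 1 (f ` C)) \<le> f c" using fin by (intro Min_le) auto
        also have "\<dots> \<le> dist c d" using f(2)[of d c] \<open>d \<in> C\<close> \<open>c \<noteq> d\<close> by auto
        finally show "Min (insert 1 (f ` C)) \<le> dist c d" .
      qed
    qed
    then show ?thesis using that by blast
  qed
  obtain T where T: "T \<ge> 0" "\<And>t. t \<ge> T \<Longrightarrow> \<exists>c\<in>C. dist (Z t) c < r0/2" using nr[of "r0/2"] r0(1) by auto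
  obtain c where c: "c \<in> C" "dist (Z T) c < r0/2" using T(2)[of T] by auto
  define V where "V = (\<Union>d\<in>C - {c}. ball d (r0/2))"
  have con: "connected (Z ` {T..})"
    by (intro connected_continuous_image continuous_on_subset[OF cont]) (use T in auto)
  have disj: "ball c (r0/2) \<inter> ball d (r0/2) = {}" if "d \<in> C - {c}" for d
    using r0(2)[of c d] that c(1) by (intro disjoint_ballI) auto
  have stay: "Z t \<in> ball c (r0/2)" if "t \<ge> T" for t
  proof (rule ccontr)
    assume n: "Z t \<notin> ball c (r0/2)"
    have "Z ` {T..} \<subseteq> ball c (r0/2) \<union> V"
      using T(2) c(1) unfolding V_def by (force simp: dist_commute)
    moreover have "ball c (r0/2) \<inter> V \<inter> Z ` {T..} = {}" using disj unfolding V_def by blast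
    moreover have "open V" unfolding V_def by blast
    ultimately have "ball c (r0/2) \<inter> Z ` {T..} = {} \<or> V \<inter> Z ` {T..} = {}"
      using connectedD[OF con, of "ball c (r0/2)" V] by blast
    moreover have "Z T \<in> ball c (r0/2) \<inter> Z ` {T..}" using c(2) by (auto simp: dist_commute)
    moreover have "Z t \<in> V \<inter> Z ` {T..}"
      using n that \<open>Z ` {T..} \<subseteq> ball c (r0/2) \<union> V\<close> by auto
    ultimately show False by blast
  qed
  have "(Z \<longlongrightarrow> c) at_top"
  proof (rule tendstoI)
    fix r :: real assume "r > 0"
    then obtain T' where T': "\<And>t. t \<ge> T' \<Longrightarrow> \<exists>c\<in>C. dist (Z t) c < min r (r0/2)" using nr[of "min r (r0/2)"] r0(1) by auto
    have "dist (Z t) c < r" if tT: "t \<ge> max T T'" for t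
    proof -
      have "\<exists>d\<in>C. dist (Z t) d < min r (r0/2)" using T'[of t] tT by simp
      then obtain d where d: "d \<in> C" "dist (Z t) d < min r (r0/2)" by blast
      have "d = c"
      proof (rule ccontr)
        assume "d \<noteq> c"
        then have "r0 \<le> dist d c" using r0(2) d c by auto
        also have "\<dots> \<le> dist (Z t) d + dist (Z t) c" by (metis dist_commute dist_triangle)
        also have "\<dots> < r0/2 + r0/2" using d(2) stay[of t] tT by (auto simp: dist_commute)
        finally show False by simp
      qed
      then show ?thesis using d by auto
    qed
    then show "\<forall>\<^sub>F t in at_top. dist (Z t) c < r"
      using eventually_at_top_linorder by blast
  qed
  then show ?thesis using c(1) by blast
qed

lemma norm_has_integral_le_ae:
  fixes f :: "real \<Rightarrow> 'a::euclidean_space"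
  assumes "(f has_integral i) {a..b}" and N: "negligible N" and "\<And>t. t \<in> {a..b} - N \<Longrightarrow> norm (f t) \<le> L"
    and "0 \<le> L" "a \<le> b"
  shows "norm i \<le> L * (b - a)"
proof -
  have "((\<lambda>t. if t \<in> N then 0 else f t) has_integral i) (cbox a b)"
    unfolding cbox_interval by (rule has_integral_spike[OF N _ assms(1)]) auto
  then have "norm i \<le> L * measure lborel (cbox a b)"
    by (rule has_integral_bound[OF \<open>0 \<le> L\<close>]) (use assms in auto)
  then show ?thesis using \<open>a \<le> b\<close> by simp
qed

section \<open>The potential and the abstract flow\<close>

definition mixed_potential :: "'a::metric_space set \<Rightarrow> 'a set \<Rightarrow> real \<Rightarrow> 'a \<Rightarrow> real" where
  "mixed_potential A B l x = l * (infdist x A)\<^sup>2 + (1 - l) * (infdist x B)\<^sup>2"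

text \<open>Completing the square, for any real \<open>l\<close>. The last term depends on the pair
  only, so it is constant wherever \<open>a\<close> and \<open>b\<close> stay nearest.\<close>

lemma mixed_potential_nearest:
  fixes x :: "'a::euclidean_space"
  assumes "a \<in> near A x" "b \<in> near B x"
  shows "mixed_potential A B l x = (norm (x - (l *\<^sub>R a + (1 - l) *\<^sub>R b)))\<^sup>2 + l * (1 - l) * (norm (a - b))\<^sup>2"
proof -
  have "infdist x A = norm (x - a)" "infdist x B = norm (x - b)"
    using assms by (auto simp: near_def dist_norm)
  then show ?thesis unfolding mixed_potential_def
    by (simp add: power2_norm_eq_inner inner_diff_left inner_diff_right inner_add_left inner_add_right
        inner_commute algebra_simps)
qed

text \<open>Common frame for the inner and the outer flow. \<open>closed_K\<close> and
  \<open>K_usc\<close> bound the speed from below away from critical points, \<open>K_subset\<close>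
  yields the energy identity and the finiteness of the critical set, and \<open>K_segment\<close>
  provides local solutions.\<close>

locale nearest_point_flow =
  fixes A B :: "'a::euclidean_space set" and l :: real and K :: "'a \<Rightarrow> 'a set"
  assumes A: "finite A" "A \<noteq> {}" and B: "finite B" "B \<noteq> {}"
    and closed_K: "closed (K x)"
    and K_usc: "\<exists>e>0. \<forall>y\<in>ball x e. K y \<subseteq> K x"
    and K_subset: "K x \<subseteq> {l *\<^sub>R p + (1 - l) *\<^sub>R q | p q. p \<in> convex hull near A x \<and> q \<in> convex hull near B x}"
    and K_segment: "\<exists>p\<in>K x. \<exists>d>0. \<forall>s\<in>{0..d}. p \<in> K (x + s *\<^sub>R (p - x))"
begin

abbreviation Phi :: "'a \<Rightarrow> real" where
  "Phi \<equiv> mixed_potential A B l"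

definition F :: "'a \<Rightarrow> 'a set" where
  "F x = (\<lambda>k. (1/2) *\<^sub>R (k - x)) ` K x"

lemma bounded_K: "\<exists>R\<ge>0. \<forall>x. \<forall>k\<in>K x. norm k \<le> R"
proof -
  have "bounded (convex hull A)" "bounded (convex hull B)"
    using A B by (simp_all add: bounded_convex_hull finite_imp_bounded)
  then obtain RA RB where R: "\<And>p. p \<in> convex hull A \<Longrightarrow> norm p \<le> RA" "\<And>q. q \<in> convex hull B \<Longrightarrow> norm q \<le> RB"
    unfolding bounded_iff by blast
  have "norm k \<le> \<bar>l\<bar> * \<bar>RA\<bar> + \<bar>1 - l\<bar> * \<bar>RB\<bar>" if kK: "k \<in> K x" for k x
  proof -
    obtain p q where k: "k = l *\<^sub>R p + (1 - l) *\<^sub>R q" "p \<in> convex hull near A x" "q \<in> convex hull near B x"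
      using K_subset[of x] kK by blast
    then have "p \<in> convex hull A" "q \<in> convex hull B" using hull_mono[OF near_subset] by blast+
    then have "norm p \<le> \<bar>RA\<bar>" "norm q \<le> \<bar>RB\<bar>" using R by fastforce+
    then have "norm (l *\<^sub>R p) \<le> \<bar>l\<bar> * \<bar>RA\<bar>" "norm ((1 - l) *\<^sub>R q) \<le> \<bar>1 - l\<bar> * \<bar>RB\<bar>"
      by (auto intro!: mult_left_mono)
    then show ?thesis unfolding k(1) using norm_triangle_le add_mono by blast
  qed
  then show ?thesis by (intro exI[of _ "\<bar>l\<bar> * \<bar>RA\<bar> + \<bar>1 - l\<bar> * \<bar>RB\<bar>"]) auto
qed

text \<open>By the completed square, \<open>Phi x + C\<close> dominates the squared distance from
  \<open>x\<close> to a combined nearest point of norm at most \<open>R\<close>; \<open>C\<close>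
  absorbs the last term, which may be negative for \<open>l > 1\<close>. The double sums are crude
  bounds for maxima over finite sets.\<close>

lemma Phi_coercive: "\<exists>C R. \<forall>x. - C \<le> Phi x \<and> norm x \<le> R + sqrt (Phi x + C)"
proof -
  define C where "C = (\<Sum>a\<in>A. \<Sum>b\<in>B. \<bar>l * (1 - l) * (norm (a - b))\<^sup>2\<bar>)"
  define R where "R = (\<Sum>a\<in>A. \<Sum>b\<in>B. norm (l *\<^sub>R a + (1 - l) *\<^sub>R b))"
  have *: "g a b \<le> (\<Sum>a\<in>A. \<Sum>b\<in>B. g a b)" if "a \<in> A" "b \<in> B" "\<And>a b. 0 \<le> g a b" for a b and g :: "'a \<Rightarrow> 'a \<Rightarrow> real"
  proof -
    have "g a b \<le> (\<Sum>b\<in>B. g a b)" using that B by (intro member_le_sum) auto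
    also have "\<dots> \<le> (\<Sum>a\<in>A. \<Sum>b\<in>B. g a b)" using that A by (intro member_le_sum) (auto intro: sum_nonneg)
    finally show ?thesis .
  qed
  have "- C \<le> Phi x \<and> norm x \<le> R + sqrt (Phi x + C)" for x
  proof -
    obtain a b where ab: "a \<in> near A x" "b \<in> near B x"
      using near_nonempty[OF A] near_nonempty[OF B] by blast
    then have ab': "a \<in> A" "b \<in> B" using near_subset by blast+
    have c: "\<bar>l * (1 - l) * (norm (a - b))\<^sup>2\<bar> \<le> C" unfolding C_def using *[OF ab', of "\<lambda>a b. \<bar>l * (1 - l) * (norm (a - b))\<^sup>2\<bar>"] by simp
    have r: "norm (l *\<^sub>R a + (1 - l) *\<^sub>R b) \<le> R" unfolding R_def using *[OF ab', of "\<lambda>a b. norm (l *\<^sub>R a + (1 - l) *\<^sub>R b)"] by simp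
    have "(norm (x - (l *\<^sub>R a + (1 - l) *\<^sub>R b)))\<^sup>2 \<le> Phi x + C" using mixed_potential_nearest[OF ab, of l] c by linarith
    moreover have "0 \<le> (norm (x - (l *\<^sub>R a + (1 - l) *\<^sub>R b)))\<^sup>2" by simp
    ultimately have "norm (x - (l *\<^sub>R a + (1 - l) *\<^sub>R b)) \<le> sqrt (Phi x + C)" "- C \<le> Phi x"
      using real_le_rsqrt by (blast, linarith)
    moreover have "norm x \<le> norm (x - (l *\<^sub>R a + (1 - l) *\<^sub>R b)) + norm (l *\<^sub>R a + (1 - l) *\<^sub>R b)"
      by (metis diff_add_cancel norm_triangle_ineq)
    ultimately show ?thesis using r by linarith
  qed
  then show ?thesis by blast
qed

text \<open>If \<open>x\<close> and \<open>y\<close> share their nearest points, these are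
  equidistant from both, so \<open>x - y\<close> is orthogonal to all differences within the common
  hulls. For critical points \<open>x - y\<close> is a combination of such differences, hence
  orthogonal to itself.\<close>

lemma inj_on_critical: "inj_on (\<lambda>x. (near A x, near B x)) {x. x \<in> K x}"
proof (rule inj_onI)
  fix x y assume x: "x \<in> {x. x \<in> K x}" and y: "y \<in> {x. x \<in> K x}" and eq: "(near A x, near B x) = (near A y, near B y)"
  have orth: "(x - y) \<bullet> p = (x - y) \<bullet> q"
    if pD: "p \<in> convex hull near D x" and qD: "q \<in> convex hull near D x" and eqD: "near D x = near D y" for p q D
  proof -
    have *: "(x - y) \<bullet> a = (x - y) \<bullet> b" if ab: "a \<in> near D x" "b \<in> near D x" for a b
    proof -
      have "dist x a = dist x b" using ab unfolding near_def by simp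
      moreover have "a \<in> near D y" "b \<in> near D y" using ab unfolding eqD .
      then have "dist y a = dist y b" unfolding near_def by simp
      ultimately have "(norm (x - a))\<^sup>2 = (norm (x - b))\<^sup>2" "(norm (y - a))\<^sup>2 = (norm (y - b))\<^sup>2" by (simp_all add: dist_norm)
      then show ?thesis
        by (simp add: power2_norm_eq_inner inner_diff_left inner_diff_right inner_commute algebra_simps)
    qed
    obtain a where a: "a \<in> near D x" using pD by fastforce
    have "near D x \<subseteq> {z. (x - y) \<bullet> z = (x - y) \<bullet> a}" using *[OF _ a] by blast
    then have "convex hull near D x \<subseteq> {z. (x - y) \<bullet> z = (x - y) \<bullet> a}"
      by (intro hull_minimal convex_hyperplane)
    then have "(x - y) \<bullet> p = (x - y) \<bullet> a" "(x - y) \<bullet> q = (x - y) \<bullet> a" using pD qD by blast+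
    then show ?thesis by simp
  qed
  obtain p q where pq: "x = l *\<^sub>R p + (1 - l) *\<^sub>R q" "p \<in> convex hull near A x" "q \<in> convex hull near B x"
    using x K_subset by blast
  obtain p' q' where pq': "y = l *\<^sub>R p' + (1 - l) *\<^sub>R q'" "p' \<in> convex hull near A y" "q' \<in> convex hull near B y"
    using y K_subset by blast
  have 1: "(x - y) \<bullet> p = (x - y) \<bullet> p'" "(x - y) \<bullet> q = (x - y) \<bullet> q'"
    using orth[of p A p'] orth[of q B q'] pq pq' eq by auto
  have "x - y = l *\<^sub>R (p - p') + (1 - l) *\<^sub>R (q - q')" by (subst pq(1), subst pq'(1)) (simp add: algebra_simps)
  then have "(x - y) \<bullet> (x - y) = l * ((x - y) \<bullet> (p - p')) + (1 - l) * ((x - y) \<bullet> (q - q'))"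
    by (metis inner_add_right inner_scaleR_right)
  then have "(x - y) \<bullet> (x - y) = 0" using 1 by (simp add: inner_diff_right)
  then show "x = y" by simp
qed

lemma finite_critical: "finite {x. x \<in> K x}"
proof (rule inj_on_finite[OF inj_on_critical])
  show "(\<lambda>x. (near A x, near B x)) ` {x. x \<in> K x} \<subseteq> Pow A \<times> Pow B" using near_subset by blast
  show "finite (Pow A \<times> Pow B)" using A B by simp
qed

text \<open>Otherwise velocities tend to \<open>0\<close> along points of \<open>W\<close>. At a
  cluster point \<open>y\<close> the targets \<open>x (r n) + 2 *\<^sub>R v (r n)\<close> eventually
  lie in the closed set \<open>K y\<close> and converge to \<open>y\<close>, which would be
  critical.\<close>

lemma speed_lower_bound:
  assumes W: "compact W" and nc: "\<And>x. x \<in> W \<Longrightarrow> x \<notin> K x"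
  shows "\<exists>c>0. \<forall>x\<in>W. \<forall>v\<in>F x. c \<le> norm v"
proof (rule ccontr)
  assume "\<not> ?thesis"
  then have "\<exists>x v. x \<in> W \<and> v \<in> F x \<and> norm v < 1 / Suc n" for n :: nat
    by (meson not_le of_nat_0_less_iff zero_less_Suc zero_less_divide_1_iff)
  then obtain x v where xv: "\<And>n::nat. x n \<in> W" "\<And>n. v n \<in> F (x n)" "\<And>n. norm (v n) < 1 / Suc n" by metis
  obtain y r where y: "y \<in> W" "strict_mono r" "(x \<circ> r) \<longlonglongrightarrow> y"
    using W xv(1) unfolding compact_def by metis
  obtain e where e: "e > 0" "\<And>z. z \<in> ball y e \<Longrightarrow> K z \<subseteq> K y" using K_usc by blast
  have "v \<longlonglongrightarrow> 0"
    by (rule Lim_null_comparison[OF _ LIMSEQ_inverse_real_of_nat])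
      (use xv(3) in \<open>auto intro!: always_eventually less_imp_le simp: inverse_eq_divide\<close>)
  then have "(v \<circ> r) \<longlonglongrightarrow> 0" using y(2) by (rule LIMSEQ_subseq_LIMSEQ)
  then have "(\<lambda>n. (x \<circ> r) n + 2 *\<^sub>R (v \<circ> r) n) \<longlonglongrightarrow> y + 2 *\<^sub>R 0" by (intro tendsto_intros y(3))
  then have lim: "(\<lambda>n. x (r n) + 2 *\<^sub>R v (r n)) \<longlonglongrightarrow> y" by simp
  have k: "x (r n) + 2 *\<^sub>R v (r n) \<in> K (x (r n))" for n
    using xv(2)[of "r n"] unfolding F_def by auto
  have "\<forall>\<^sub>F n in sequentially. x (r n) \<in> ball y e"
    using y(3) e(1) unfolding tendsto_iff by (simp add: dist_commute)
  then have "\<forall>\<^sub>F n in sequentially. x (r n) + 2 *\<^sub>R v (r n) \<in> K y"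
    by eventually_elim (use e(2) k in blast)
  then have "y \<in> K y" using closed_K lim by (intro Lim_in_closed_set[OF closed_K _ _ lim]) auto
  then show False using nc y(1) by blast
qed

end

section \<open>Energy and asymptotics of a given solution\<close>

lemma negligible_countable_real:
  fixes S :: "real set"
  assumes "countable S"
  shows "negligible S"
  unfolding negligible_iff_null_sets
  by (rule null_sets_completionI, rule countable_imp_null_set_lborel, rule assms)

text \<open>A solution rephrased with gauge integrals and a negligible exceptional set;
  \<open>R\<close> bounds all the sets \<open>K x\<close> uniformly.\<close>

locale flow_solution = nearest_point_flow +
  fixes Z \<xi> :: "real \<Rightarrow> 'a" and z0 :: 'a and N :: "real set" and R :: real
  assumes N: "negligible N"
    and \<xi>_F: "\<And>t. t \<ge> 0 \<Longrightarrow> t \<notin> N \<Longrightarrow> \<xi> t \<in> F (Z t)"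
    and \<xi>_integrable: "\<And>T. T \<ge> 0 \<Longrightarrow> \<xi> integrable_on {0..T}"
    and Z_eq: "\<And>t. t \<ge> 0 \<Longrightarrow> Z t = z0 + integral {0..t} \<xi>"
    and R: "R \<ge> 0" "\<And>x k. k \<in> K x \<Longrightarrow> norm k \<le> R"
begin

lemma F_norm_le:
  assumes "v \<in> F x" "norm x \<le> M"
  shows "norm v \<le> (R + M) / 2"
proof -
  obtain k where k: "k \<in> K x" "v = (1/2) *\<^sub>R (k - x)" using assms(1) unfolding F_def by blast
  have "norm (k - x) \<le> R + M" using R(2)[OF k(1)] assms(2) norm_triangle_ineq4[of k x] by linarith
  then show ?thesis unfolding k(2) by simp
qed

lemma has_integral_\<xi>:
  assumes "0 \<le> a" "a \<le> b"
  shows "(\<xi> has_integral (Z b - Z a)) {a..b}"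
proof -
  have "\<xi> integrable_on {a..b}"
    using integrable_subinterval_real[OF \<xi>_integrable[of b], of a b] assms by simp
  moreover have "integral {0..a} \<xi> + integral {a..b} \<xi> = integral {0..b} \<xi>"
    using Henstock_Kurzweil_Integration.integral_combine[of 0 a b \<xi>] \<xi>_integrable[of b] assms by simp
  then have "integral {a..b} \<xi> = Z b - Z a"
    using Z_eq[of a] Z_eq[of b] assms by (simp add: algebra_simps)
  ultimately show ?thesis using integrable_integral[of \<xi> "{a..b}"] by simp
qed

lemma lipschitz_if_bounded:
  assumes "0 \<le> a" and bd: "\<And>t. t \<in> {a..b} \<Longrightarrow> norm (Z t) \<le> M" and M: "0 \<le> M"
  shows "((R + M) / 2)-lipschitz_on {a..b} Z"
proof -
  have *: "norm (Z t - Z s) \<le> (R + M) / 2 * (t - s)" if st: "s \<in> {a..b}" "t \<in> {a..b}" "s \<le> t" for s t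
  proof (rule norm_has_integral_le_ae[OF _ N])
    show "(\<xi> has_integral (Z t - Z s)) {s..t}" using has_integral_\<xi> st assms(1) by simp
    show "norm (\<xi> u) \<le> (R + M) / 2" if "u \<in> {s..t} - N" for u
      using F_norm_le[OF \<xi>_F[of u] bd[of u]] that st assms(1) by simp
  qed (use st R M in auto)
  have "dist (Z s) (Z t) \<le> (R + M) / 2 * dist s t" if st: "s \<in> {a..b}" "t \<in> {a..b}" for s t
  proof (cases "s \<le> t")
    case True then show ?thesis using *[OF st] by (simp add: dist_norm norm_minus_commute)
  next
    case False then show ?thesis using *[OF st(2,1)] by (simp add: dist_norm)
  qed
  then show ?thesis using R M by (intro lipschitz_onI) auto
qed

lemma continuous_Z: "continuous_on {0..T} Z"
proof (cases "T \<ge> 0")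
  case True
  have "continuous_on {0..T} (\<lambda>t. z0 + integral {0..t} \<xi>)"
    by (intro continuous_intros indefinite_integral_continuous_1 \<xi>_integrable True)
  then show ?thesis by (rule continuous_on_eq) (simp add: Z_eq)
qed simp

lemma locally_bounded_Z: "\<exists>M\<ge>0. \<forall>t\<in>{0..T}. norm (Z t) \<le> M"
proof -
  have "bounded (Z ` {0..T})"
    by (intro compact_imp_bounded compact_continuous_image continuous_Z) simp
  then obtain M where "\<forall>x\<in>Z ` {0..T}. norm x \<le> M" unfolding bounded_iff by blast
  then show ?thesis by (intro exI[of _ "max 0 M"]) (auto simp: le_max_iff_disj)
qed

lemma has_vector_derivative_ae:
  obtains N' where "negligible N'"
    and "\<And>t. t \<in> {0<..<T} \<Longrightarrow> t \<notin> N' \<Longrightarrow> (Z has_vector_derivative \<xi> t) (at t)"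
    and "\<And>t. t \<in> {0<..<T} \<Longrightarrow> t \<notin> N' \<Longrightarrow> \<xi> t \<in> F (Z t)"
proof (cases "T > 0")
  case True
  define N' where "N' = {t \<in> {0<..<T}. \<not> ((\<lambda>u. integral {0..u} \<xi>) has_vector_derivative \<xi> t) (at t)}"
  have "negligible N'" unfolding N'_def
    by (rule negligible_not_indefinite_integral_deriv) (use True \<xi>_integrable in auto)
  then have "negligible (N' \<union> N)" using N by (rule negligible_Un)
  then show ?thesis
  proof (rule that)
    fix t assume t: "t \<in> {0<..<T}" "t \<notin> N' \<union> N"
    show "\<xi> t \<in> F (Z t)" using t by (intro \<xi>_F) auto
    have "((\<lambda>u. integral {0..u} \<xi>) has_vector_derivative \<xi> t) (at t)" using t unfolding N'_def by simp
    then have "((\<lambda>u. z0 + integral {0..u} \<xi>) has_vector_derivative 0 + \<xi> t) (at t)"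
      by (intro has_vector_derivative_add has_vector_derivative_const)
    then have "((\<lambda>u. z0 + integral {0..u} \<xi>) has_vector_derivative \<xi> t) (at t)" by simp
    then show "(Z has_vector_derivative \<xi> t) (at t)"
      by (rule has_vector_derivative_transform_within_open[of _ _ _ "{0<..}"]) (use t Z_eq in auto)
  qed
next
  case False
  then show ?thesis by (intro that[of "{}"]) auto
qed

lemma lipschitz_infdist_sq:
  fixes D :: "'a set"
  assumes lip: "L-lipschitz_on {0..T} Z" and bd: "\<And>t. t \<in> {0..T} \<Longrightarrow> norm (Z t) \<le> M" and M: "0 \<le> M"
  shows "\<exists>L'. L'-lipschitz_on {0..T} (\<lambda>t. (infdist (Z t) D)\<^sup>2)"
proof -
  have L0: "0 \<le> L" using lip by (rule lipschitz_on_nonneg)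
  define C where "C = M + infdist 0 D"
  have C: "infdist (Z t) D \<le> C" if "t \<in> {0..T}" for t
    using infdist_triangle[of "Z t" D 0] bd[OF that] unfolding C_def by simp
  have C0: "0 \<le> C" unfolding C_def using M infdist_nonneg[of 0 D] by linarith
  have "dist ((infdist (Z s) D)\<^sup>2) ((infdist (Z t) D)\<^sup>2) \<le> (L * (2 * C)) * dist s t"
    if st: "s \<in> {0..T}" "t \<in> {0..T}" for s t
  proof -
    have "\<bar>infdist (Z s) D - infdist (Z t) D\<bar> \<le> dist (Z s) (Z t)"
      using infdist_triangle[of "Z t" D "Z s"] infdist_triangle[of "Z s" D "Z t"] by (simp add: dist_commute)
    also have "\<dots> \<le> L * dist s t" using lipschitz_onD[OF lip st] .
    finally have 1: "\<bar>infdist (Z s) D - infdist (Z t) D\<bar> \<le> L * dist s t" .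
    have 2: "\<bar>infdist (Z s) D + infdist (Z t) D\<bar> \<le> 2 * C"
      using C[OF st(1)] C[OF st(2)] infdist_nonneg[of "Z s" D] infdist_nonneg[of "Z t" D] by simp
    have "dist ((infdist (Z s) D)\<^sup>2) ((infdist (Z t) D)\<^sup>2)
      = \<bar>infdist (Z s) D - infdist (Z t) D\<bar> * \<bar>infdist (Z s) D + infdist (Z t) D\<bar>"
      by (simp add: dist_real_def abs_mult[symmetric] power2_eq_square algebra_simps)
    also have "\<dots> \<le> (L * dist s t) * (2 * C)" using 1 2 L0 by (intro mult_mono) auto
    finally show ?thesis by (simp add: mult_ac)
  qed
  then show ?thesis using L0 C0 by (intro exI[of _ "L * (2 * C)"] lipschitz_onI) auto
qed

text \<open>Since \<open>\<xi> t = (k - Z t) / 2\<close> with \<open>k = l p + (1 - l) q\<close>,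
  inserting exactly these \<open>p\<close> and \<open>q\<close> in the chain rule gives the
  derivative \<open>2 (Z t - k) \<bullet> \<xi> t = - 4 |\<xi> t|^2\<close>. The energy is Lipschitz
  along the curve on bounded intervals, so it is recovered from this derivative.\<close>

lemma energy_identity:
  assumes "0 \<le> a" "a \<le> b"
  shows "((\<lambda>t. (norm (vector_derivative Z (at t)))\<^sup>2) has_integral (Phi (Z a) - Phi (Z b)) / 4) {a..b}"
proof -
  \<comment> \<open>\<open>T\<close> exceeds \<open>b + 1\<close>, the right end required for
    recovering a function from its right derivative, and keeps \<open>b\<close> inside the open
    interval \<open>{0<..<T}\<close>.\<close>
  define T where "T = b + 2"
  obtain M where M: "M \<ge> 0" "\<And>t. t \<in> {0..T} \<Longrightarrow> norm (Z t) \<le> M" using locally_bounded_Z by blast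
  have lip: "((R + M) / 2)-lipschitz_on {0..T} Z" using M by (intro lipschitz_if_bounded) auto
  obtain LA LB where LA: "LA-lipschitz_on {0..T} (\<lambda>t. (infdist (Z t) A)\<^sup>2)"
    and LB: "LB-lipschitz_on {0..T} (\<lambda>t. (infdist (Z t) B)\<^sup>2)"
    using lipschitz_infdist_sq[OF lip M(2) M(1)] by meson
  have "(\<bar>l\<bar> * LA + \<bar>1 - l\<bar> * LB)-lipschitz_on {0..T} (\<lambda>t. Phi (Z t))"
    unfolding mixed_potential_def by (intro lipschitz_on_add lipschitz_on_cmult_real LA LB)
  then have lipPhi: "(\<bar>l\<bar> * LA + \<bar>1 - l\<bar> * LB)-lipschitz_on {a..b + 1} (\<lambda>t. Phi (Z t))"
    by (rule lipschitz_on_subset) (use assms in \<open>auto simp: T_def\<close>)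
  obtain N1 where N1: "negligible N1"
    "\<And>t. t \<in> {0<..<T} \<Longrightarrow> t \<notin> N1 \<Longrightarrow> (Z has_vector_derivative \<xi> t) (at t)"
    "\<And>t. t \<in> {0<..<T} \<Longrightarrow> t \<notin> N1 \<Longrightarrow> \<xi> t \<in> F (Z t)"
    using has_vector_derivative_ae[of T] by metis
  \<comment> \<open>Time \<open>0\<close> is added because the derivative of \<open>Z\<close> is
    two-sided and values at negative times are arbitrary.\<close>
  define N2 where "N2 = N1 \<union> (isolated_coincidences Z A \<union> isolated_coincidences Z B \<union> {0})"
  have negN2: "negligible N2" unfolding N2_def
    using A B by (intro negligible_Un N1(1) negligible_countable_real countable_isolated_coincidences) auto
  define dZ where "dZ t = vector_derivative Z (at t)" for t
  have "((\<lambda>t. - 4 * (norm (dZ t))\<^sup>2) has_integral (Phi (Z b) - Phi (Z a))) {a..b}"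
  proof (rule lipschitz_has_integral_right_derivative[OF lipPhi assms(2) negN2])
    fix t assume t: "t \<in> {a..b} - N2"
    then have t': "t \<in> {0<..<T}" "t \<notin> N1" using assms unfolding N2_def T_def by auto
    have d: "(Z has_vector_derivative \<xi> t) (at t)" and xF: "\<xi> t \<in> F (Z t)" using N1(2,3)[OF t'] .
    obtain p q where pq: "\<xi> t = (1/2) *\<^sub>R ((l *\<^sub>R p + (1 - l) *\<^sub>R q) - Z t)"
      "p \<in> convex hull near A (Z t)" "q \<in> convex hull near B (Z t)"
      using xF K_subset unfolding F_def by blast
    have "((\<lambda>s. Phi (Z s)) has_vector_derivative
        l * (2 * ((Z t - p) \<bullet> \<xi> t)) + (1 - l) * (2 * ((Z t - q) \<bullet> \<xi> t))) (at t)"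
      unfolding mixed_potential_def using t A B pq
      by (intro has_vector_derivative_add has_vector_derivative_mult_right infdist_sq_has_derivative d)
        (auto simp: N2_def)
    moreover have "l * (2 * ((Z t - p) \<bullet> \<xi> t)) + (1 - l) * (2 * ((Z t - q) \<bullet> \<xi> t)) = - 4 * (norm (\<xi> t))\<^sup>2"
    proof -
      have "l * (2 * ((Z t - p) \<bullet> \<xi> t)) + (1 - l) * (2 * ((Z t - q) \<bullet> \<xi> t))
        = 2 * ((Z t - (l *\<^sub>R p + (1 - l) *\<^sub>R q)) \<bullet> \<xi> t)"
        by (simp add: inner_diff_left inner_add_left algebra_simps)
      also have "Z t - (l *\<^sub>R p + (1 - l) *\<^sub>R q) = (- 2) *\<^sub>R \<xi> t"
        by (subst pq(1)) (simp add: algebra_simps)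
      finally show ?thesis by (simp add: power2_norm_eq_inner)
    qed
    moreover have "dZ t = \<xi> t" unfolding dZ_def using d by (rule vector_derivative_at)
    ultimately show "((\<lambda>t. Phi (Z t)) has_vector_derivative - 4 * (norm (dZ t))\<^sup>2) (at_right t)"
      by (simp add: has_vector_derivative_at_within)
  qed
  then have "((\<lambda>t. (- 1/4) * (- 4 * (norm (dZ t))\<^sup>2)) has_integral (- 1/4) * (Phi (Z b) - Phi (Z a))) {a..b}"
    by (rule has_integral_mult_right)
  moreover have "(\<lambda>t. (- 1/4) * (- 4 * (norm (dZ t))\<^sup>2)) = (\<lambda>t. (norm (vector_derivative Z (at t)))\<^sup>2)"
    by (rule ext) (simp add: dZ_def)
  moreover have "(- 1/4) * (Phi (Z b) - Phi (Z a)) = (Phi (Z a) - Phi (Z b)) / 4"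
    by (simp add: field_simps)
  ultimately show ?thesis by (simp only:)
qed

lemma Phi_antimono:
  assumes "0 \<le> a" "a \<le> b"
  shows "Phi (Z b) \<le> Phi (Z a)"
  using has_integral_nonneg[OF energy_identity[OF assms]] by simp

lemma bounded_Z: "\<exists>M\<ge>0. \<forall>t\<ge>0. norm (Z t) \<le> M"
proof -
  obtain C R' where C: "\<And>x. - C \<le> Phi x \<and> norm x \<le> R' + sqrt (Phi x + C)" using Phi_coercive by blast
  have "norm (Z t) \<le> R' + sqrt (Phi (Z 0) + C)" if "t \<ge> 0" for t
  proof -
    have "sqrt (Phi (Z t) + C) \<le> sqrt (Phi (Z 0) + C)" using Phi_antimono[of 0 t] that by simp
    then show ?thesis using C[of "Z t"] by linarith
  qed
  then have "\<forall>t\<ge>0. norm (Z t) \<le> max 0 (R' + sqrt (Phi (Z 0) + C))" by (simp add: le_max_iff_disj)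
  then show ?thesis by (intro exI[of _ "max 0 (R' + sqrt (Phi (Z 0) + C))"]) simp
qed

text \<open>If the curve were far from the critical points at arbitrarily late times, each such time
  would start a period of fixed length \<open>h\<close> outside their \<open>r/2\<close>
  neighbourhood, with speed at least \<open>s\<close> and energy loss at least
  \<open>4 * (s\<^sup>2 * h)\<close>. One such loss, started late enough, undercuts the infimum
  \<open>m\<close> of the energy.\<close>

lemma eventually_near_critical:
  assumes r: "r > 0"
  shows "\<exists>T\<ge>0. \<forall>t\<ge>T. \<exists>c\<in>{x. x \<in> K x}. dist (Z t) c < r"
proof (rule ccontr)
  let ?C = "{x. x \<in> K x}"
  assume "\<not> ?thesis"
  then have far: "\<exists>t\<ge>T. \<forall>c\<in>?C. r \<le> dist (Z t) c" if "T \<ge> 0" for T using that by (meson not_less)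
  obtain M where M: "M \<ge> 0" "\<And>t. t \<ge> 0 \<Longrightarrow> norm (Z t) \<le> M" using bounded_Z by blast
  define W where "W = cball 0 M - (\<Union>c\<in>?C. ball c (r/2))"
  have "compact W" unfolding W_def by (intro compact_diff compact_cball open_UN) auto
  moreover have "x \<notin> K x" if "x \<in> W" for x using that r unfolding W_def by force
  ultimately obtain s where s: "s > 0" "\<And>x v. x \<in> W \<Longrightarrow> v \<in> F x \<Longrightarrow> s \<le> norm v"
    using speed_lower_bound by meson
  define L where "L = (R + M) / 2 + 1"
  have L: "L > 0" unfolding L_def using R M by (simp add: add_nonneg_pos)
  have lip: "dist (Z t) (Z u) \<le> L * dist t u" if tu: "t \<ge> 0" "u \<ge> 0" for t u
  proof -
    have "((R + M) / 2)-lipschitz_on {0..max t u} Z" using M by (intro lipschitz_if_bounded) auto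
    then have "dist (Z t) (Z u) \<le> (R + M) / 2 * dist t u" by (rule lipschitz_onD) (use tu in auto)
    also have "\<dots> \<le> L * dist t u" unfolding L_def by (intro mult_right_mono) auto
    finally show ?thesis .
  qed
  \<comment> \<open>In time \<open>h\<close> a curve with Lipschitz constant \<open>L\<close> moves
    by at most \<open>r/2\<close>; the summand \<open>1\<close> in \<open>L\<close> keeps the
    quotient meaningful.\<close>
  define h where "h = r / (2 * L)"
  have h: "h > 0" unfolding h_def using r L by simp
  have loss: "Phi (Z (t + h)) \<le> Phi (Z t) - 4 * (s\<^sup>2 * h)" if t: "t \<ge> 0" "\<forall>c\<in>?C. r \<le> dist (Z t) c" for t
  proof -
    have inW: "Z u \<in> W" if u: "u \<in> {t..t + h}" for u
    proof -
      have "dist (Z t) (Z u) \<le> L * dist t u" using lip t u by auto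
      also have "\<dots> \<le> L * h" using L u by (intro mult_left_mono) (auto simp: dist_real_def)
      also have "\<dots> = r/2" using L unfolding h_def by simp
      finally have "dist (Z t) (Z u) \<le> r/2" .
      have "Z u \<notin> ball c (r/2)" if c: "c \<in> ?C" for c
      proof -
        have "r \<le> dist (Z t) c" using t(2) c by blast
        also have "\<dots> \<le> dist (Z t) (Z u) + dist (Z u) c" by (rule dist_triangle)
        finally have "r/2 \<le> dist (Z u) c" using \<open>dist (Z t) (Z u) \<le> r/2\<close> by linarith
        then show ?thesis by (simp add: dist_commute)
      qed
      then show ?thesis using M(2)[of u] t(1) u unfolding W_def by auto
    qed
    obtain N1 where N1: "negligible N1"
      "\<And>u. u \<in> {0<..<t + h + 1} \<Longrightarrow> u \<notin> N1 \<Longrightarrow> (Z has_vector_derivative \<xi> u) (at u)"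
      "\<And>u. u \<in> {0<..<t + h + 1} \<Longrightarrow> u \<notin> N1 \<Longrightarrow> \<xi> u \<in> F (Z u)"
      using has_vector_derivative_ae[of "t + h + 1"] by metis
    have "negligible (N1 \<union> {0})" using N1(1) by simp
    have e: "((\<lambda>t. (norm (vector_derivative Z (at t)))\<^sup>2) has_integral (Phi (Z t) - Phi (Z (t + h))) / 4) {t..t + h}"
      using t h by (intro energy_identity) auto
    \<comment> \<open>On the exceptional set the integrand is replaced by \<open>s\<^sup>2\<close>,
      so that the lower bound holds at every time.\<close>
    have "((\<lambda>u. if u \<in> N1 \<union> {0} then s\<^sup>2 else (norm (vector_derivative Z (at u)))\<^sup>2) has_integral (Phi (Z t) - Phi (Z (t + h))) / 4) {t..t + h}"
      by (rule has_integral_spike[OF \<open>negligible (N1 \<union> {0})\<close> _ e]) simp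
    moreover have "((\<lambda>u. s\<^sup>2) has_integral (s\<^sup>2 * h)) {t..t + h}"
      using has_integral_const_real[of "s\<^sup>2" t "t + h"] h by (simp add: mult.commute)
    moreover have "s\<^sup>2 \<le> (if u \<in> N1 \<union> {0} then s\<^sup>2 else (norm (vector_derivative Z (at u)))\<^sup>2)" if u: "u \<in> {t..t + h}" for u
    proof (cases "u \<in> N1 \<union> {0}")
      case False
      then have "u \<in> {0<..<t + h + 1}" "u \<notin> N1" using u t(1) by auto
      then have "vector_derivative Z (at u) = \<xi> u" "\<xi> u \<in> F (Z u)"
        using N1(2,3) vector_derivative_at by blast+
      then have "s \<le> norm (vector_derivative Z (at u))" using s(2) inW[OF u] by simp
      then show ?thesis using False s(1) by (simp add: power_mono)
    qed simp
    ultimately have "s\<^sup>2 * h \<le> (Phi (Z t) - Phi (Z (t + h))) / 4" by (metis (no_types, lifting) has_integral_le)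
    then show ?thesis by simp
  qed
  obtain C where C: "\<And>x. - C \<le> Phi x" using Phi_coercive by blast
  define m where "m = Inf ((\<lambda>t. Phi (Z t)) ` {0..})"
  have bb: "bdd_below ((\<lambda>t. Phi (Z t)) ` {0..})" using C by (intro bdd_belowI2[of _ "- C"]) auto
  have "Inf ((\<lambda>t. Phi (Z t)) ` {0..}) < m + 4 * (s\<^sup>2 * h)" using s h unfolding m_def by simp
  from cInf_lessD[OF _ this] obtain T where T: "T \<ge> 0" "Phi (Z T) < m + 4 * (s\<^sup>2 * h)"
    by auto
  obtain t where t: "t \<ge> T" "\<forall>c\<in>?C. r \<le> dist (Z t) c" using far[OF T(1)] by blast
  have "m \<le> Phi (Z (t + h))" unfolding m_def by (intro cInf_lower bb) (use t T h in auto)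
  also have "\<dots> \<le> Phi (Z t) - 4 * (s\<^sup>2 * h)" using loss t T(1) by simp
  also have "\<dots> \<le> Phi (Z T) - 4 * (s\<^sup>2 * h)" using Phi_antimono[of T t] t T by simp
  also have "\<dots> < m" using T(2) by simp
  finally show False by simp
qed

lemma converges: "\<exists>x. x \<in> K x \<and> (Z \<longlongrightarrow> x) at_top"
proof -
  have "continuous_on {0..} Z"
  proof -
    obtain M where M: "M \<ge> 0" "\<And>t. t \<ge> 0 \<Longrightarrow> norm (Z t) \<le> M" using bounded_Z by blast
    have *: "((R + M) / 2)-lipschitz_on {0..T} Z" for T using M by (intro lipschitz_if_bounded) auto
    have "((R + M) / 2)-lipschitz_on {0..} Z"
    proof (rule lipschitz_onI)
      show "0 \<le> (R + M) / 2" using R M by simp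
      fix s t :: real assume "s \<in> {0..}" "t \<in> {0..}"
      then show "dist (Z s) (Z t) \<le> (R + M) / 2 * dist s t"
        using lipschitz_onD[OF *[of "max s t"]] by auto
    qed
    then show ?thesis by (rule lipschitz_on_continuous_on)
  qed
  then show ?thesis
    using converges_if_near_finite_set[OF finite_critical _ eventually_near_critical] by blast
qed

end

context nearest_point_flow
begin

theorem solution_properties:
  assumes sol: "caratheodory_solution F z0 Z"
  shows "\<And>a b. 0 \<le> a \<Longrightarrow> a \<le> b \<Longrightarrow>
      ((\<lambda>t. (norm (vector_derivative Z (at t)))\<^sup>2) has_integral (Phi (Z a) - Phi (Z b)) / 4) {a..b}"
    and "\<exists>x. x \<in> K x \<and> (Z \<longlongrightarrow> x) at_top"
proof -
  obtain \<xi> where ae: "AE \<tau> in lebesgue_on {0..}. \<xi> \<tau> \<in> F (Z \<tau>)"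
    and int: "\<And>\<tau>. \<tau> \<ge> 0 \<Longrightarrow> set_integrable lebesgue {0..\<tau>} \<xi>"
    and eq: "\<And>\<tau>. \<tau> \<ge> 0 \<Longrightarrow> Z \<tau> = z0 + (LINT s:{0..\<tau>}|lebesgue. \<xi> s)"
    using sol unfolding caratheodory_solution_def by blast
  have "AE \<tau> in lebesgue. \<tau> \<in> {0..} \<longrightarrow> \<xi> \<tau> \<in> F (Z \<tau>)"
    using ae by (subst (asm) AE_restrict_space_iff) auto
  then obtain N where N: "N \<in> null_sets lebesgue" "{\<tau> \<in> space lebesgue. \<not> (\<tau> \<in> {0..} \<longrightarrow> \<xi> \<tau> \<in> F (Z \<tau>))} \<subseteq> N"
    unfolding eventually_ae_filter by blast
  obtain R where R: "R \<ge> 0" "\<And>x k. k \<in> K x \<Longrightarrow> norm k \<le> R" using bounded_K by blast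
  interpret flow_solution A B l K Z \<xi> z0 N R
  proof unfold_locales
    show "negligible N" using N(1) by (simp add: negligible_iff_null_sets)
    show "\<xi> t \<in> F (Z t)" if "t \<ge> 0" "t \<notin> N" for t using N(2) that by auto
    show "\<xi> integrable_on {0..T}" if "T \<ge> 0" for T
      using set_lebesgue_integral_eq_integral(1)[OF int[OF that]] .
    show "Z t = z0 + integral {0..t} \<xi>" if "t \<ge> 0" for t
      using eq[OF that] set_lebesgue_integral_eq_integral(2)[OF int[OF that]] by simp
  qed (fact R)+
  show "\<And>a b. 0 \<le> a \<Longrightarrow> a \<le> b \<Longrightarrow>
      ((\<lambda>t. (norm (vector_derivative Z (at t)))\<^sup>2) has_integral (Phi (Z a) - Phi (Z b)) / 4) {a..b}"
    by (rule energy_identity)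
  show "\<exists>x. x \<in> K x \<and> (Z \<longlongrightarrow> x) at_top" by (rule converges)
qed

end

section \<open>Existence of solutions\<close>

lemma abs_continuous_on_interval_if_lipschitz:
  fixes Z :: "real \<Rightarrow> 'a::real_normed_vector"
  assumes "L-lipschitz_on {a..b} Z"
  shows "abs_continuous_on_interval a b Z"
  unfolding abs_continuous_on_interval_def
proof (intro allI impI)
  fix e :: real assume "e > 0"
  have L: "0 \<le> L" using assms by (rule lipschitz_on_nonneg)
  show "\<exists>d>0. \<forall>(n::nat) s t.
        (\<forall>i<n. a \<le> s i \<and> s i \<le> t i \<and> t i \<le> b) \<and>
        disjoint_family_on (\<lambda>i. {s i<..<t i}) {..<n} \<and>
        (\<Sum>i<n. t i - s i) < d \<longrightarrow>
        (\<Sum>i<n. norm (Z (t i) - Z (s i))) < e"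
  \<comment> \<open>\<open>L + 1\<close> instead of \<open>L\<close> avoids division by zero and
    makes the final inequality strict.\<close>
  proof (intro exI[of _ "e / (L + 1)"] conjI allI impI)
    show "0 < e / (L + 1)" using \<open>e > 0\<close> L by simp
    fix n :: nat and s t :: "nat \<Rightarrow> real"
    assume *: "(\<forall>i<n. a \<le> s i \<and> s i \<le> t i \<and> t i \<le> b) \<and>
        disjoint_family_on (\<lambda>i. {s i<..<t i}) {..<n} \<and> (\<Sum>i<n. t i - s i) < e / (L + 1)"
    have "(\<Sum>i<n. norm (Z (t i) - Z (s i))) \<le> (\<Sum>i<n. L * (t i - s i))"
    proof (rule sum_mono)
      fix i assume "i \<in> {..<n}"
      then have "a \<le> s i" "s i \<le> t i" "t i \<le> b" using * by auto
      then show "norm (Z (t i) - Z (s i)) \<le> L * (t i - s i)"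
        using lipschitz_onD[OF assms, of "t i" "s i"] by (simp add: dist_norm)
    qed
    also have "\<dots> = L * (\<Sum>i<n. t i - s i)" by (simp add: sum_distrib_left)
    also have "\<dots> \<le> L * (e / (L + 1))" using * L by (intro mult_left_mono) auto
    also have "\<dots> < e" using \<open>e > 0\<close> L by (simp add: field_simps)
    finally show "(\<Sum>i<n. norm (Z (t i) - Z (s i))) < e" .
  qed
qed

lemma abs_exp_diff_le:
  fixes a b :: real
  assumes "a \<le> 0" "b \<le> 0"
  shows "\<bar>exp a - exp b\<bar> \<le> \<bar>a - b\<bar>"
proof -
  have *: "exp y - exp x \<le> y - x" if "x \<le> y" "y \<le> 0" for x y :: real
  proof -
    have "exp y - exp x = exp y * (1 - exp (x - y))" by (simp add: algebra_simps exp_diff)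
    also have "\<dots> \<le> 1 * (1 - exp (x - y))" using that by (intro mult_right_mono) auto
    also have "\<dots> \<le> 1 * (1 - (1 + (x - y)))"
      by (intro mult_left_mono diff_left_mono exp_ge_add_one_self) simp
    also have "\<dots> = y - x" by simp
    finally show ?thesis .
  qed
  show ?thesis
  proof (cases "a \<le> b")
    case True then show ?thesis using *[OF True assms(2)] by simp
  next
    case False then show ?thesis using *[of b a] assms by simp
  qed
qed

text \<open>Solution of \<open>y' = (p - y) / 2\<close> with \<open>y 0 = x\<close>.\<close>

definition relax :: "'a::real_normed_vector \<Rightarrow> 'a \<Rightarrow> real \<Rightarrow> 'a" where
  "relax p x s = p + exp (- s / 2) *\<^sub>R (x - p)"

lemma relax_0 [simp]: "relax p x 0 = x"
  by (simp add: relax_def)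

lemma relax_relax: "relax p (relax p x s) t = relax p x (s + t)"
proof -
  have "exp (- t / 2) * exp (- s / 2) = exp (- (s + t) / 2)"
    by (simp add: exp_add[symmetric] field_simps)
  then show ?thesis unfolding relax_def by simp
qed

lemma norm_relax_le:
  assumes "norm p \<le> M" "norm x \<le> M" "0 \<le> s"
  shows "norm (relax p x s) \<le> M"
proof -
  have "relax p x s = (1 - exp (- s / 2)) *\<^sub>R p + exp (- s / 2) *\<^sub>R x"
    by (simp add: relax_def algebra_simps)
  then have "norm (relax p x s) \<le> (1 - exp (- s / 2)) * norm p + exp (- s / 2) * norm x"
    using norm_triangle_ineq[of "(1 - exp (- s / 2)) *\<^sub>R p" "exp (- s / 2) *\<^sub>R x"] assms(3) by simp
  also have "\<dots> \<le> (1 - exp (- s / 2)) * M + exp (- s / 2) * M"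
    using assms by (intro add_mono mult_left_mono) auto
  finally show ?thesis by (simp add: algebra_simps)
qed

lemma norm_relax_diff_le:
  assumes "norm p \<le> M" "norm x \<le> M" "0 \<le> s" "0 \<le> t"
  shows "norm (relax p x t - relax p x s) \<le> M * \<bar>t - s\<bar>"
proof -
  have "relax p x t - relax p x s = (exp (- t / 2) - exp (- s / 2)) *\<^sub>R (x - p)"
    by (simp add: relax_def scaleR_diff_left)
  then have "norm (relax p x t - relax p x s) = \<bar>exp (- t / 2) - exp (- s / 2)\<bar> * norm (x - p)" by simp
  also have "\<dots> \<le> \<bar>- t / 2 - (- s / 2)\<bar> * (2 * M)"
    using assms abs_exp_diff_le[of "- t / 2" "- s / 2"] norm_triangle_ineq4[of x p]
    by (intro mult_mono) auto
  also have "\<dots> = M * \<bar>t - s\<bar>" by (simp add: abs_if field_simps)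
  finally show ?thesis .
qed

lemma relax_has_vector_derivative:
  "((\<lambda>s. relax p x (s - t)) has_vector_derivative (1/2) *\<^sub>R (p - x)) (at t within S)"
proof -
  have "((\<lambda>s. exp (- (s - t) / 2)) has_real_derivative - 1/2) (at t within S)"
    by (auto intro!: derivative_eq_intros)
  then have "((\<lambda>s. exp (- (s - t) / 2) *\<^sub>R (x - p)) has_vector_derivative (- 1/2) *\<^sub>R (x - p)) (at t within S)"
    unfolding has_real_derivative_iff_has_vector_derivative
    by (rule bounded_linear.has_vector_derivative[OF bounded_linear_scaleR_left])
  then have "((\<lambda>s. p + exp (- (s - t) / 2) *\<^sub>R (x - p)) has_vector_derivative 0 + (- 1/2) *\<^sub>R (x - p)) (at t within S)"
    by (intro has_vector_derivative_add has_vector_derivative_const)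
  moreover have "0 + (- 1/2) *\<^sub>R (x - p) = (1/2) *\<^sub>R (p - x)" by (simp add: scaleR_diff_right)
  ultimately show ?thesis unfolding relax_def by (simp only:)
qed

section \<open>Local solutions and their gluing\<close>

context nearest_point_flow
begin

text \<open>The relaxation runs along the segment from \<open>x\<close> to \<open>p\<close>,
  reparametrised by \<open>1 - exp (- s / 2) \<le> s / 2\<close>; it therefore stays in the good
  part up to time \<open>2 * d\<close>.\<close>

lemma relax_in_K:
  "\<exists>p\<in>K x. \<exists>d>0. \<forall>s\<in>{0..<d}. p \<in> K (relax p x s)"
proof -
  obtain p d where p: "p \<in> K x" "d > 0" "\<And>s. s \<in> {0..d} \<Longrightarrow> p \<in> K (x + s *\<^sub>R (p - x))"
    using K_segment[of x] by blast
  have "p \<in> K (relax p x s)" if s: "s \<in> {0..<2 * d}" for s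
  proof -
    have "relax p x s = x + (1 - exp (- s / 2)) *\<^sub>R (p - x)"
      by (simp add: relax_def algebra_simps)
    moreover have "1 - exp (- s / 2) \<in> {0..d}"
      using exp_ge_add_one_self[of "- s / 2"] s by auto
    ultimately show ?thesis using p(3) by simp
  qed
  then show ?thesis using p(1,2) by (intro bexI[of _ p] exI[of _ "2 * d"]) auto
qed

text \<open>Curves are encoded as graphs, so that chains have unions. The Lipschitz clause with
  \<open>s = t\<close> makes the graph single-valued, the next one makes the domain an interval
  starting at \<open>0\<close>, and the last one makes it open at its right end.\<close>

definition partial_solution :: "'a \<Rightarrow> real \<Rightarrow> (real \<times> 'a) set \<Rightarrow> bool" where
  "partial_solution z0 M G \<longleftrightarrow> (0, z0) \<in> G \<and>
     (\<forall>t x. (t, x) \<in> G \<longrightarrow> 0 \<le> t \<and> norm x \<le> M) \<and>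
     (\<forall>s x t y. (s, x) \<in> G \<longrightarrow> (t, y) \<in> G \<longrightarrow> norm (y - x) \<le> M * \<bar>t - s\<bar>) \<and>
     (\<forall>t x s. (t, x) \<in> G \<longrightarrow> s \<in> {0..t} \<longrightarrow> (\<exists>y. (s, y) \<in> G)) \<and>
     (\<forall>t x. (t, x) \<in> G \<longrightarrow> (\<exists>p\<in>K x. \<exists>d>0. \<forall>s\<in>{t..<t + d}. (s, relax p x (s - t)) \<in> G))"

lemma partial_solutionD:
  assumes "partial_solution z0 M G"
  shows "(0, z0) \<in> G"
    and "(t, x) \<in> G \<Longrightarrow> 0 \<le> t" "(t, x) \<in> G \<Longrightarrow> norm x \<le> M"
    and "(s, x) \<in> G \<Longrightarrow> (t, y) \<in> G \<Longrightarrow> norm (y - x) \<le> M * \<bar>t - s\<bar>"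
    and "(t, x) \<in> G \<Longrightarrow> s \<in> {0..t} \<Longrightarrow> \<exists>y. (s, y) \<in> G"
    and "(t, x) \<in> G \<Longrightarrow> \<exists>p\<in>K x. \<exists>d>0. \<forall>s\<in>{t..<t + d}. (s, relax p x (s - t)) \<in> G"
  using assms unfolding partial_solution_def by blast+

definition relax_piece :: "'a \<Rightarrow> 'a \<Rightarrow> real \<Rightarrow> real \<Rightarrow> (real \<times> 'a) set" where
  "relax_piece p x t d = (\<lambda>s. (s, relax p x (s - t))) ` {t..<t + d}"

text \<open>By the semigroup law \<open>relax_relax\<close>, restarting at a later point with the
  same target \<open>p\<close> reproduces the rest of the piece.\<close>

lemma relax_piece_continues:
  assumes p: "\<And>s. s \<in> {0..<d} \<Longrightarrow> p \<in> K (relax p x s)"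
    and s: "(s, y) \<in> relax_piece p x t d"
  shows "\<exists>q\<in>K y. \<exists>d'>0. \<forall>u\<in>{s..<s + d'}. (u, relax q y (u - s)) \<in> relax_piece p x t d"
proof (intro bexI[of _ p] exI[of _ "t + d - s"] conjI ballI)
  have y: "y = relax p x (s - t)" "s \<in> {t..<t + d}" using s unfolding relax_piece_def by auto
  show "p \<in> K y" unfolding y(1) using y(2) by (intro p) auto
  show "0 < t + d - s" using y(2) by auto
  fix u assume u: "u \<in> {s..<s + (t + d - s)}"
  have "relax p y (u - s) = relax p x (u - t)" unfolding y(1) relax_relax by simp
  moreover have "u \<in> {t..<t + d}" using u y(2) by auto
  ultimately show "(u, relax p y (u - s)) \<in> relax_piece p x t d" unfolding relax_piece_def by simp
qed

lemma partial_solution_initial: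
  assumes M: "\<And>x k. k \<in> K x \<Longrightarrow> norm k \<le> M" "norm z0 \<le> M"
  shows "\<exists>G. partial_solution z0 M G"
proof -
  obtain p d where p: "p \<in> K z0" "d > 0" "\<And>s. s \<in> {0..<d} \<Longrightarrow> p \<in> K (relax p z0 s)"
    using relax_in_K[of z0] by blast
  have pM: "norm p \<le> M" using p(1) M(1) by blast
  have mem: "(s, y) \<in> relax_piece p z0 0 d \<longleftrightarrow> s \<in> {0..<d} \<and> y = relax p z0 s" for s y
    unfolding relax_piece_def by auto
  have "partial_solution z0 M (relax_piece p z0 0 d)"
    unfolding partial_solution_def
  proof (intro conjI allI impI)
    show "(0, z0) \<in> relax_piece p z0 0 d" unfolding mem using p(2) by simp
    show "0 \<le> t" if "(t, x) \<in> relax_piece p z0 0 d" for t x using that unfolding mem by simp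
    show "norm x \<le> M" if "(t, x) \<in> relax_piece p z0 0 d" for t x
      using that norm_relax_le[OF pM M(2), of t] unfolding mem by simp
    show "norm (y - x) \<le> M * \<bar>t - s\<bar>" if "(s, x) \<in> relax_piece p z0 0 d" "(t, y) \<in> relax_piece p z0 0 d" for s x t y
      using that norm_relax_diff_le[OF pM M(2), of s t] unfolding mem by simp
    show "\<exists>y. (s, y) \<in> relax_piece p z0 0 d" if "(t, x) \<in> relax_piece p z0 0 d" "s \<in> {0..t}" for t x s
      using that unfolding mem by simp
    show "\<exists>q\<in>K x. \<exists>d'>0. \<forall>s\<in>{t..<t + d'}. (s, relax q x (s - t)) \<in> relax_piece p z0 0 d"
      if "(t, x) \<in> relax_piece p z0 0 d" for t x
      by (rule relax_piece_continues) (use p(3) that in auto)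
  qed
  then show ?thesis by blast
qed

text \<open>The domain is \<open>{0..<T}\<close> with its supremum \<open>T\<close> missing. Being
  Lipschitz, the curve has a limit \<open>x\<close> at \<open>T\<close>, and a relaxation starting
  from \<open>x\<close> is appended. The constant \<open>M\<close> persists because targets and
  states of norm at most \<open>M\<close> give velocities \<open>(k - x) / 2\<close> of norm at most
  \<open>M\<close>.\<close>

lemma partial_solution_extend:
  assumes M: "\<And>x k. k \<in> K x \<Longrightarrow> norm k \<le> M"
    and G: "partial_solution z0 M G" and bdd: "bdd_above (fst ` G)"
  shows "\<exists>G'. partial_solution z0 M G' \<and> G \<subset> G'"
proof -
  define T where "T = Sup (fst ` G)"
  have ne: "fst ` G \<noteq> {}" using partial_solutionD(1)[OF G] by auto
  \<comment> \<open>Every point of the graph has a continuation, so no time of the domain reaches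
    \<open>T\<close>.\<close>
  have lt: "t < T" if tx: "(t, x) \<in> G" for t x
  proof -
    obtain p d where d: "d > 0" "\<forall>s\<in>{t..<t + d}. (s, relax p x (s - t)) \<in> G"
      using partial_solutionD(6)[OF G tx] by blast
    have "(t + d/2, relax p x (t + d/2 - t)) \<in> G" using d(1) by (intro d(2)[rule_format]) auto
    then have "t + d/2 \<in> fst ` G" by (rule rev_image_eqI) simp
    then have "t + d/2 \<le> T" unfolding T_def using bdd by (rule cSup_upper)
    then show ?thesis using d(1) by simp
  qed
  have T0: "0 < T" using lt[OF partial_solutionD(1)[OF G]] .
  have dom: "\<exists>x. (t, x) \<in> G" if t: "t \<in> {0..<T}" for t
  proof -
    have "t < Sup (fst ` G)" using t unfolding T_def by simp
    then obtain s where "s \<in> fst ` G" "t < s" using less_cSup_iff[OF ne bdd] by blast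
    then obtain x where "(s, x) \<in> G" by auto
    then show ?thesis using partial_solutionD(5)[OF G, of s x t] t \<open>t < s\<close> by simp
  qed
  define z where "z t = (SOME x. (t, x) \<in> G)" for t
  have z: "(t, z t) \<in> G" if "t \<in> {0..<T}" for t
    using dom[OF that] unfolding z_def by (rule someI_ex)
  have M0: "0 \<le> M" using partial_solutionD(3)[OF G partial_solutionD(1)[OF G]] norm_ge_zero order_trans by blast
  have "M-lipschitz_on {0..<T} z"
  proof (rule lipschitz_onI[OF _ M0])
    fix s t assume "s \<in> {0..<T}" "t \<in> {0..<T}"
    then show "dist (z s) (z t) \<le> M * dist s t"
      using partial_solutionD(4)[OF G z[of t] z[of s]] by (simp add: dist_norm dist_real_def)
  qed
  then obtain g where g: "M-lipschitz_on (closure {0..<T}) g" "\<And>t. t \<in> {0..<T} \<Longrightarrow> g t = z t"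
    using lipschitz_extend_closure by blast
  have cl: "closure {0..<T} = {0..T}" using T0 by simp
  define x where "x = g T"
  have xM: "norm x \<le> M"
    unfolding x_def
  proof (rule continuous_on_closure_norm_le[of "{0..<T}" g M T])
    show "continuous_on (closure {0..<T}) g" using g(1) by (rule lipschitz_on_continuous_on)
    show "\<forall>y\<in>{0..<T}. norm (g y) \<le> M" using g(2) partial_solutionD(3)[OF G z] by simp
    show "T \<in> closure {0..<T}" unfolding cl using T0 by simp
  qed
  \<comment> \<open>The Lipschitz bound between \<open>x\<close> and all earlier points survives the
    passage to the closure; bounds across \<open>T\<close> are then split at \<open>T\<close> in
    \<open>GH\<close>.\<close>
  have xG: "norm (x - y) \<le> M * (T - s)" if sy: "(s, y) \<in> G" for s y
  proof -
    have s: "s \<in> {0..<T}" using lt[OF sy] partial_solutionD(2)[OF G sy] by simp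
    have "norm (z s - y) \<le> M * \<bar>s - s\<bar>" using partial_solutionD(4)[OF G sy z[OF s]] .
    then have "y = g s" using g(2)[OF s] by simp
    moreover have "dist (g T) (g s) \<le> M * dist T s"
      by (rule lipschitz_onD[OF g(1)]) (use s in \<open>auto simp: cl\<close>)
    ultimately show ?thesis unfolding x_def using s by (simp add: dist_norm)
  qed
  obtain p d where p: "p \<in> K x" "d > 0" "\<And>s. s \<in> {0..<d} \<Longrightarrow> p \<in> K (relax p x s)"
    using relax_in_K[of x] by blast
  have pM: "norm p \<le> M" using p(1) M(1) by blast
  define H where "H = relax_piece p x T d"
  have mem: "(s, y) \<in> H \<longleftrightarrow> s \<in> {T..<T + d} \<and> y = relax p x (s - T)" for s y
    unfolding H_def relax_piece_def by auto
  have GH: "norm (y - y') \<le> M * \<bar>t - s\<bar>" if sy: "(s, y') \<in> G" and ty: "(t, y) \<in> H" for s t y y'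
  proof -
    have t: "t \<in> {T..<T + d}" "y = relax p x (t - T)" using ty unfolding mem by auto
    have "norm (y - x) \<le> M * (t - T)"
      using norm_relax_diff_le[OF pM xM, of 0 "t - T"] t by simp
    moreover have "norm (y - y') \<le> norm (y - x) + norm (x - y')"
      using norm_triangle_ineq[of "y - x" "x - y'"] by simp
    moreover have "M * \<bar>t - s\<bar> = M * (t - T) + M * (T - s)"
      using t lt[OF sy] by (simp add: algebra_simps)
    ultimately show ?thesis using xG[OF sy] by linarith
  qed
  have HH: "norm (y - y') \<le> M * \<bar>t - s\<bar>" if "(s, y') \<in> H" "(t, y) \<in> H" for s t y y'
    using that norm_relax_diff_le[OF pM xM, of "s - T" "t - T"] unfolding mem by simp
  have "partial_solution z0 M (G \<union> H)"
    unfolding partial_solution_def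
  proof (intro conjI allI impI)
    show "(0, z0) \<in> G \<union> H" using partial_solutionD(1)[OF G] by simp
    show "0 \<le> t" if "(t, y) \<in> G \<union> H" for t y
      using that partial_solutionD(2)[OF G] T0 unfolding Un_iff mem by force
    show "norm y \<le> M" if "(t, y) \<in> G \<union> H" for t y
      using that partial_solutionD(3)[OF G] norm_relax_le[OF pM xM] unfolding Un_iff mem by auto
    show "norm (y - y') \<le> M * \<bar>t - s\<bar>" if sy: "(s, y') \<in> G \<union> H" and ty: "(t, y) \<in> G \<union> H" for s y' t y
    proof -
      consider "(s, y') \<in> G" "(t, y) \<in> G" | "(s, y') \<in> G" "(t, y) \<in> H"
        | "(s, y') \<in> H" "(t, y) \<in> G" | "(s, y') \<in> H" "(t, y) \<in> H" using sy ty by blast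
      then show ?thesis
      proof cases
        case 1 then show ?thesis by (rule partial_solutionD(4)[OF G])
      next
        case 2 then show ?thesis by (rule GH)
      next
        case 3 then show ?thesis using GH[of t y s y'] by (simp add: norm_minus_commute abs_minus_commute)
      next
        case 4 then show ?thesis by (rule HH)
      qed
    qed
    show "\<exists>y'. (s, y') \<in> G \<union> H" if ty: "(t, y) \<in> G \<union> H" and s: "s \<in> {0..t}" for t y s
    proof (cases "s < T")
      case True then show ?thesis using z[of s] s by auto
    next
      case False
      then have "t \<notin> {0..<T}" using s by auto
      then have "(t, y) \<notin> G" using lt partial_solutionD(2)[OF G] by auto
      then have "(s, relax p x (s - T)) \<in> H" using ty s False unfolding Un_iff mem by auto
      then show ?thesis by blast
    qed
    show "\<exists>q\<in>K y. \<exists>d'>0. \<forall>s\<in>{t..<t + d'}. (s, relax q y (s - t)) \<in> G \<union> H"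
      if ty: "(t, y) \<in> G \<union> H" for t y
    proof (cases "(t, y) \<in> G")
      case True
      then show ?thesis using partial_solutionD(6)[OF G True] by blast
    next
      case False
      then have "(t, y) \<in> relax_piece p x T d" using ty unfolding H_def by simp
      then have "\<exists>q\<in>K y. \<exists>d'>0. \<forall>s\<in>{t..<t + d'}. (s, relax q y (s - t)) \<in> relax_piece p x T d"
        by (rule relax_piece_continues[rotated]) (use p(3) in auto)
      then show ?thesis unfolding H_def by blast
    qed
  qed
  moreover have "(T, x) \<in> H" unfolding mem using p(2) by simp
  moreover have "(T, x) \<notin> G" using lt by blast
  ultimately show ?thesis by (intro exI[of _ "G \<union> H"]) blast
qed

text \<open>Every clause starts from at most two points of the graph, and in a chain one member
  contains both.\<close>

lemma partial_solution_Union: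
  assumes "\<C> \<noteq> {}" and chain: "subset.chain {G. partial_solution z0 M G} \<C>"
  shows "partial_solution z0 M (\<Union>\<C>)"
proof -
  have ps: "partial_solution z0 M G" if "G \<in> \<C>" for G
    using chain that unfolding subset.chain_def by blast
  have tot: "G \<subseteq> H \<or> H \<subseteq> G" if "G \<in> \<C>" "H \<in> \<C>" for G H
    using chain that unfolding subset_chain_def by blast
  show ?thesis
    unfolding partial_solution_def
  proof (intro conjI allI impI)
    show "(0, z0) \<in> \<Union>\<C>" using assms(1) ps partial_solutionD(1) by blast
    show "0 \<le> t" if "(t, y) \<in> \<Union>\<C>" for t y using that ps partial_solutionD(2) by blast
    show "norm y \<le> M" if "(t, y) \<in> \<Union>\<C>" for t y using that ps partial_solutionD(3) by blast
    show "norm (y - x) \<le> M * \<bar>t - s\<bar>" if sx: "(s, x) \<in> \<Union>\<C>" and ty: "(t, y) \<in> \<Union>\<C>" for s x t y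
    proof -
      obtain G H where G: "G \<in> \<C>" "(s, x) \<in> G" and H: "H \<in> \<C>" "(t, y) \<in> H" using sx ty by blast
      then consider "(t, y) \<in> G" | "(s, x) \<in> H" using tot by blast
      then show ?thesis
        by cases (use G H partial_solutionD(4)[OF ps[OF G(1)]] partial_solutionD(4)[OF ps[OF H(1)]] in blast)+
    qed
    show "\<exists>y'. (s, y') \<in> \<Union>\<C>" if ty: "(t, y) \<in> \<Union>\<C>" and s: "s \<in> {0..t}" for t y s
    proof -
      obtain G where G: "G \<in> \<C>" "(t, y) \<in> G" using ty by blast
      show ?thesis using partial_solutionD(5)[OF ps[OF G(1)] G(2) s] G(1) by blast
    qed
    show "\<exists>q\<in>K y. \<exists>d'>0. \<forall>s\<in>{t..<t + d'}. (s, relax q y (s - t)) \<in> \<Union>\<C>" if ty: "(t, y) \<in> \<Union>\<C>" for t y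
    proof -
      obtain G where G: "G \<in> \<C>" "(t, y) \<in> G" using ty by blast
      obtain q d where "q \<in> K y" "d > 0" "\<forall>s\<in>{t..<t + d}. (s, relax q y (s - t)) \<in> G"
        using partial_solutionD(6)[OF ps[OF G(1)] G(2)] by blast
      then show ?thesis using G(1) by (intro bexI[of _ q] exI[of _ d]) auto
    qed
  qed
qed

text \<open>A maximal partial solution has unbounded domain, since otherwise it could be extended.
  Its right derivative at \<open>t\<close> is that of the relaxation piece starting there.\<close>

lemma lipschitz_right_solution:
  obtains Z M where "0 \<le> M" "Z 0 = z0" "\<And>t. t \<ge> 0 \<Longrightarrow> norm (Z t) \<le> M" "M-lipschitz_on {0..} Z"
    and "\<And>x k. k \<in> K x \<Longrightarrow> norm k \<le> M"
    and "\<And>t. t \<ge> 0 \<Longrightarrow> \<exists>v\<in>F (Z t). (Z has_vector_derivative v) (at_right t)"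
proof -
  obtain R where R: "R \<ge> 0" "\<And>x k. k \<in> K x \<Longrightarrow> norm k \<le> R" using bounded_K by blast
  define M where "M = max R (norm z0)"
  have M: "\<And>x k. k \<in> K x \<Longrightarrow> norm k \<le> M" "norm z0 \<le> M" "0 \<le> M"
    using R unfolding M_def by (auto simp: le_max_iff_disj)
  have "{G. partial_solution z0 M G} \<noteq> {}" using partial_solution_initial[OF M(1,2)] by simp
  then obtain G where G: "partial_solution z0 M G"
    and maximal: "\<And>G'. partial_solution z0 M G' \<Longrightarrow> G \<subseteq> G' \<Longrightarrow> G' = G"
    using subset_Zorn_nonempty[of "{G. partial_solution z0 M G}"] partial_solution_Union by (metis mem_Collect_eq)
  have "\<not> bdd_above (fst ` G)"
    using partial_solution_extend[of M z0 G] M(1) G maximal by blast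
  then have dom: "\<exists>x. (t, x) \<in> G" if t: "t \<ge> 0" for t
  proof -
    obtain s where "s \<in> fst ` G" "t < s" using \<open>\<not> bdd_above (fst ` G)\<close> unfolding bdd_above_def by (meson not_le)
    then obtain x where "(s, x) \<in> G" by auto
    then show ?thesis using partial_solutionD(5)[OF G, of s x t] t \<open>t < s\<close> by simp
  qed
  define Z where "Z t = (SOME x. (t, x) \<in> G)" for t
  have Z: "(t, Z t) \<in> G" if "t \<ge> 0" for t
    using dom[OF that] unfolding Z_def by (rule someI_ex)
  have Z_unique: "Z t = x" if tx: "(t, x) \<in> G" for t x
    using partial_solutionD(4)[OF G tx Z[OF partial_solutionD(2)[OF G tx]]] by simp
  show ?thesis
  proof (rule that[of M Z])
    show "0 \<le> M" by (rule M(3))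
    show "Z 0 = z0" by (rule Z_unique[OF partial_solutionD(1)[OF G]])
    show "norm (Z t) \<le> M" if "t \<ge> 0" for t using partial_solutionD(3)[OF G Z[OF that]] .
    show "M-lipschitz_on {0..} Z"
    proof (rule lipschitz_onI[OF _ M(3)])
      fix s t :: real assume "s \<in> {0..}" "t \<in> {0..}"
      then show "dist (Z s) (Z t) \<le> M * dist s t"
        using partial_solutionD(4)[OF G Z[of t] Z[of s]] by (simp add: dist_norm dist_real_def)
    qed
    show "norm k \<le> M" if "k \<in> K x" for x k using M(1)[OF that] .
    show "\<exists>v\<in>F (Z t). (Z has_vector_derivative v) (at_right t)" if t: "t \<ge> 0" for t
    proof -
      obtain p d where p: "p \<in> K (Z t)" "d > 0" "\<And>s. s \<in> {t..<t + d} \<Longrightarrow> (s, relax p (Z t) (s - t)) \<in> G"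
        using partial_solutionD(6)[OF G Z[OF t]] by blast
      have "(Z has_vector_derivative (1/2) *\<^sub>R (p - Z t)) (at t within {t..t + d/2})"
      proof (rule has_vector_derivative_transform[of t "{t..t + d/2}" Z "\<lambda>s. relax p (Z t) (s - t)"])
        show "t \<in> {t..t + d/2}" using p(2) by simp
        show "Z s = relax p (Z t) (s - t)" if "s \<in> {t..t + d/2}" for s
          by (rule Z_unique, rule p(3)) (use that p(2) in simp)
      qed (rule relax_has_vector_derivative)
      then have "(Z has_vector_derivative (1/2) *\<^sub>R (p - Z t)) (at_right t)"
        using p(2) by (simp add: at_within_Icc_at_right)
      moreover have "(1/2) *\<^sub>R (p - Z t) \<in> F (Z t)" unfolding F_def using p(1) by blast
      ultimately show ?thesis by blast
    qed
  qed
qed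

theorem solution_exists: "\<exists>Z. caratheodory_solution F z0 Z"
proof -
  obtain Z M where M: "0 \<le> M" and Z0: "Z 0 = z0" and ZM: "\<And>t. t \<ge> 0 \<Longrightarrow> norm (Z t) \<le> M"
    and lip: "M-lipschitz_on {0..} Z" and KM: "\<And>x k. k \<in> K x \<Longrightarrow> norm k \<le> M"
    and der: "\<And>t. t \<ge> 0 \<Longrightarrow> \<exists>v\<in>F (Z t). (Z has_vector_derivative v) (at_right t)"
    using lipschitz_right_solution[of z0] by metis
  \<comment> \<open>A velocity is fixed at every time \<open>t \<ge> 0\<close>, so the fundamental
    theorem for right derivatives applies with an empty exceptional set.\<close>
  define \<xi> where "\<xi> t = (SOME v. v \<in> F (Z t) \<and> (Z has_vector_derivative v) (at_right t))" for t
  have \<xi>: "\<xi> t \<in> F (Z t)" "(Z has_vector_derivative \<xi> t) (at_right t)" if "t \<ge> 0" for t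
    using someI_ex[OF der[OF that, unfolded Bex_def]] unfolding \<xi>_def by auto
  have bd: "norm (\<xi> t) \<le> M" if t: "t \<ge> 0" for t
  proof -
    obtain k where k: "k \<in> K (Z t)" "\<xi> t = (1/2) *\<^sub>R (k - Z t)" using \<xi>(1)[OF t] unfolding F_def by blast
    have "norm (k - Z t) \<le> 2 * M" using norm_triangle_ineq4[of k "Z t"] KM[OF k(1)] ZM[OF t] by linarith
    then show ?thesis unfolding k(2) by simp
  qed
  have int: "(\<xi> has_integral (Z \<tau> - Z 0)) {0..\<tau>}" if "\<tau> \<ge> 0" for \<tau>
    by (rule lipschitz_has_integral_right_derivative[of M _ _ _ "{}"])
      (use that lip \<xi>(2) in \<open>auto intro: lipschitz_on_subset\<close>)
  have sint: "set_integrable lebesgue {0..\<tau>} \<xi>" if "\<tau> \<ge> 0" for \<tau>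
    by (rule absolutely_integrable_integrable_bound[of _ _ "\<lambda>_. M"]) (use bd int[OF that] in auto)
  \<comment> \<open>Measurability is not visible from the choice of \<open>\<xi>\<close>; it comes
    from integrability on each \<open>{0..real n}\<close> by a pointwise limit.\<close>
  have "\<xi> \<in> borel_measurable (lebesgue_on {0..})"
  proof -
    have "(\<lambda>t. indicator {0..} t *\<^sub>R \<xi> t) \<in> borel_measurable lebesgue"
    proof (rule borel_measurable_LIMSEQ_metric)
      fix n :: nat
      show "(\<lambda>t. indicator {0..real n} t *\<^sub>R \<xi> t) \<in> borel_measurable lebesgue"
        using sint[of "real n"] unfolding set_integrable_def by auto
    next
      fix t :: real
      obtain m :: nat where m: "t \<le> real m" using real_arch_simple by blast
      have "\<forall>\<^sub>F n in sequentially. indicator {0..} t *\<^sub>R \<xi> t = indicator {0..real n} t *\<^sub>R \<xi> t"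
        unfolding eventually_sequentially
        by (intro exI[of _ m]) (use m in \<open>auto simp: indicator_def\<close>)
      then show "(\<lambda>n. indicator {0..real n} t *\<^sub>R \<xi> t) \<longlonglongrightarrow> indicator {0..} t *\<^sub>R \<xi> t"
        by (rule Lim_transform_eventually[rotated]) simp
    qed
    then show ?thesis by (subst borel_measurable_restrict_space_iff) auto
  qed
  moreover have "AE \<tau> in lebesgue_on {0..}. \<xi> \<tau> \<in> F (Z \<tau>)"
    by (rule AE_I2) (use \<xi>(1) in auto)
  moreover have "Z \<tau> = z0 + (LINT s:{0..\<tau>}|lebesgue. \<xi> s)" if "\<tau> \<ge> 0" for \<tau>
    using set_lebesgue_integral_eq_integral(2)[OF sint[OF that]] integral_unique[OF int[OF that]] Z0 by simp
  moreover have "abs_continuous_on_interval 0 T Z" for T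
    by (rule abs_continuous_on_interval_if_lipschitz[OF lipschitz_on_subset[OF lip]]) auto
  ultimately show ?thesis unfolding caratheodory_solution_def using sint by blast
qed

end

section \<open>Clarke subdifferentials of the potential\<close>

text \<open>The region where \<open>f\<close> has the gradient of the squared distance to
  \<open>p\<close>.\<close>

definition grad_set :: "('a::real_inner \<Rightarrow> real) \<Rightarrow> 'a \<Rightarrow> 'a set" where
  "grad_set f p = {y. GDERIV f y :> 2 *\<^sub>R (y - p)}"

text \<open>Along an approximating sequence the points \<open>X k - (1/2) *\<^sub>R G k\<close>
  converge within the finite set \<open>S\<close>, so they eventually equal one \<open>p\<close>,
  and \<open>x\<close> is in the closure of the region of \<open>p\<close>. The affine map to
  gradients commutes with the convex hull.\<close>

lemma clarke_subdifferential_finite_gradients: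
  fixes f :: "'a::euclidean_space \<Rightarrow> real"
  assumes S: "finite S" and f: "\<And>y v. GDERIV f y :> v \<Longrightarrow> \<exists>p\<in>S. v = 2 *\<^sub>R (y - p)"
  shows "clarke_subdifferential f x =
    (\<lambda>p. 2 *\<^sub>R (x - p)) ` (convex hull {p \<in> S. x \<in> closure (grad_set f p)})"
proof -
  let ?P = "{p \<in> S. x \<in> closure (grad_set f p)}"
  have "{v. \<exists>X G. X \<longlonglongrightarrow> x \<and> (\<forall>k::nat. GDERIV f (X k) :> G k) \<and> G \<longlonglongrightarrow> v} = (\<lambda>p. 2 *\<^sub>R (x - p)) ` ?P"
  proof (intro equalityI subsetI)
    fix v assume "v \<in> {v. \<exists>X G. X \<longlonglongrightarrow> x \<and> (\<forall>k::nat. GDERIV f (X k) :> G k) \<and> G \<longlonglongrightarrow> v}"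
    then obtain X G where XG: "X \<longlonglongrightarrow> x" "\<And>k::nat. GDERIV f (X k) :> G k" "G \<longlonglongrightarrow> v" by blast
    define P where "P k = X k - (1/2) *\<^sub>R G k" for k
    define p where "p = x - (1/2) *\<^sub>R v"
    have G: "G k = 2 *\<^sub>R (X k - P k)" for k unfolding P_def by simp
    have PS: "P k \<in> S" for k using f[OF XG(2)[of k]] unfolding P_def by auto
    have lim: "P \<longlonglongrightarrow> p" unfolding P_def p_def by (intro tendsto_intros XG)
    have "p \<in> S" by (rule closed_sequentially[OF finite_imp_closed[OF S] PS lim])
    have "open (- (S - {p}))" using S by (intro open_Compl finite_imp_closed) simp
    then have "\<forall>\<^sub>F k in sequentially. P k \<in> - (S - {p})"
      by (rule topological_tendstoD[OF lim]) simp
    then have "\<forall>\<^sub>F k in sequentially. X k \<in> closure (grad_set f p)"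
    proof eventually_elim
      case (elim k)
      then have "P k = p" using PS[of k] by blast
      then have "X k \<in> grad_set f p" using XG(2)[of k] G[of k] unfolding grad_set_def by simp
      then show ?case using closure_subset by blast
    qed
    then have "x \<in> closure (grad_set f p)"
      by (intro Lim_in_closed_set[OF closed_closure _ _ XG(1)]) auto
    then show "v \<in> (\<lambda>p. 2 *\<^sub>R (x - p)) ` ?P" using \<open>p \<in> S\<close> by (intro image_eqI[of _ _ p]) (auto simp: p_def)
  next
    fix v assume "v \<in> (\<lambda>p. 2 *\<^sub>R (x - p)) ` ?P"
    then obtain p where p: "v = 2 *\<^sub>R (x - p)" "x \<in> closure (grad_set f p)" by blast
    then obtain X where X: "\<And>k. X k \<in> grad_set f p" "X \<longlonglongrightarrow> x" unfolding closure_sequential by blast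
    have "(\<lambda>k. 2 *\<^sub>R (X k - p)) \<longlonglongrightarrow> v" unfolding p(1) by (intro tendsto_intros X)
    moreover have "\<forall>k. GDERIV f (X k) :> 2 *\<^sub>R (X k - p)" using X(1) unfolding grad_set_def by blast
    ultimately show "v \<in> {v. \<exists>X G. X \<longlonglongrightarrow> x \<and> (\<forall>k::nat. GDERIV f (X k) :> G k) \<and> G \<longlonglongrightarrow> v}"
      using X(2) by (intro CollectI exI[of _ X] exI[of _ "\<lambda>k. 2 *\<^sub>R (X k - p)"]) simp
  qed
  moreover have "(\<lambda>p. 2 *\<^sub>R (x - p)) = (\<lambda>p. 2 *\<^sub>R x + (- 2) *\<^sub>R p)"
    by (simp add: scaleR_diff_right)
  ultimately show ?thesis unfolding clarke_subdifferential_def by (simp only: convex_hull_affinity)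
qed

text \<open>\<open>g - f\<close> has a minimum at \<open>y\<close>, so its gradient vanishes
  there.\<close>

lemma gderiv_eq_if_touching:
  fixes f g :: "'a::real_inner \<Rightarrow> real"
  assumes f: "GDERIV f y :> v" and g: "GDERIV g y :> w" and le: "\<And>z. f z \<le> g z" and eq: "f y = g y"
  shows "v = w"
proof -
  have "((\<lambda>z. g z - f z) has_derivative (\<lambda>h. h \<bullet> (w - v))) (at y)"
    using GDERIV_diff[OF g f] unfolding gderiv_def .
  then have "(\<lambda>h. h \<bullet> (w - v)) = (\<lambda>h. 0)"
    by (rule has_derivative_local_min) (simp add: le eq)
  then have "(w - v) \<bullet> (w - v) = 0" by (rule fun_cong)
  then show ?thesis by simp
qed

lemma gderiv_norm_sq: "GDERIV (\<lambda>z. (norm (z - p))\<^sup>2 + c) y :> 2 *\<^sub>R (y - p)"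
proof -
  have "((\<lambda>z. (z - p) \<bullet> (z - p) + c) has_derivative (\<lambda>h. (y - p) \<bullet> h + h \<bullet> (y - p))) (at y)"
    by (auto intro!: derivative_eq_intros)
  then show ?thesis unfolding gderiv_def power2_norm_eq_inner
    by (rule has_derivative_eq_rhs) (auto simp: inner_commute)
qed

section \<open>Combined nearest points and gradients of the potential\<close>

definition near_pairs :: "'a::real_normed_vector set \<Rightarrow> 'a set \<Rightarrow> real \<Rightarrow> 'a \<Rightarrow> 'a set" where
  "near_pairs A B l x = (\<lambda>(a, b). l *\<^sub>R a + (1 - l) *\<^sub>R b) ` (near A x \<times> near B x)"

lemma near_pairs_iff:
  "p \<in> near_pairs A B l x \<longleftrightarrow> (\<exists>a\<in>near A x. \<exists>b\<in>near B x. p = l *\<^sub>R a + (1 - l) *\<^sub>R b)"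
  unfolding near_pairs_def by auto

lemma near_pairs_1: "finite A \<Longrightarrow> A \<noteq> {} \<Longrightarrow> near_pairs A A 1 x = near A x"
  using near_nonempty[of A x] unfolding near_pairs_def by (auto simp: image_iff)

lemma mixed_potential_1: "mixed_potential A B 1 = (\<lambda>x. (infdist x A)\<^sup>2)"
  by (simp add: mixed_potential_def fun_eq_iff)

lemma closed_near_pairs:
  fixes A :: "'a::real_normed_vector set"
  assumes "finite A" "finite B"
  shows "closed {x. p \<in> near_pairs A B l x}"
proof -
  have "{x. p \<in> near_pairs A B l x} =
    (\<Union>(a, b)\<in>{(a, b) \<in> A \<times> B. p = l *\<^sub>R a + (1 - l) *\<^sub>R b}. {x. a \<in> near A x} \<inter> {x. b \<in> near B x})"
    unfolding near_pairs_iff using near_subset by fastforce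
  moreover have "finite {(a, b) \<in> A \<times> B. p = l *\<^sub>R a + (1 - l) *\<^sub>R b}"
    by (rule finite_subset[of _ "A \<times> B"]) (use assms in auto)
  ultimately show ?thesis
    using closed_near assms by (auto intro!: closed_UN closed_Int)
qed

text \<open>For small \<open>s\<close> only nearest points of \<open>x\<close> compete. Their
  squared distances from \<open>x + s *\<^sub>R v\<close> differ only in the term
  \<open>- 2 * s * (a \<bullet> v)\<close>, so the winners are the maximisers of
  \<open>a \<bullet> v\<close>.\<close>

lemma near_direction:
  fixes A :: "'a::euclidean_space set"
  assumes A: "finite A" "A \<noteq> {}"
  shows "\<exists>d>0. \<forall>s\<in>{0<..d}. near A (x + s *\<^sub>R v) = {a \<in> near A x. \<forall>b\<in>near A x. b \<bullet> v \<le> a \<bullet> v}"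
proof -
  obtain e where e: "e > 0" "\<And>y. y \<in> ball x e \<Longrightarrow> near A y \<subseteq> near A x"
    using near_locally_subset[OF A(1)] by blast
  define d where "d = e / (norm v + 1)"
  have nv: "norm v + 1 > 0" by (simp add: add_nonneg_pos)
  have "near A (x + s *\<^sub>R v) = {a \<in> near A x. \<forall>b\<in>near A x. b \<bullet> v \<le> a \<bullet> v}" if s: "s \<in> {0<..d}" for s
  proof -
    let ?y = "x + s *\<^sub>R v"
    have "s * norm v < s * (norm v + 1)" using s by simp
    also have "\<dots> \<le> d * (norm v + 1)" using s by (intro mult_right_mono) auto
    also have "\<dots> = e" using nv unfolding d_def by simp
    finally have "?y \<in> ball x e" using s by (simp add: dist_norm)
    then have sub: "near A ?y \<subseteq> near A x" by (rule e(2))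
    have cmp: "dist ?y a \<le> dist ?y b \<longleftrightarrow> b \<bullet> v \<le> a \<bullet> v" if ab: "a \<in> near A x" "b \<in> near A x" for a b
    proof -
      have "norm (x - a) = norm (x - b)" using ab unfolding near_def by (simp add: dist_norm)
      then have eq: "(x - a) \<bullet> (x - a) = (x - b) \<bullet> (x - b)" by (simp add: norm_eq)
      have "dist ?y a \<le> dist ?y b \<longleftrightarrow> (?y - a) \<bullet> (?y - a) \<le> (?y - b) \<bullet> (?y - b)"
        by (simp add: dist_norm norm_le)
      also have "(?y - a) \<bullet> (?y - a) = (x - a) \<bullet> (x - a) + 2 * s * ((x - a) \<bullet> v) + s\<^sup>2 * (v \<bullet> v)"
        by (simp add: inner_diff_left inner_diff_right inner_add_left inner_add_right inner_commute power2_eq_square algebra_simps)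
      also have "(?y - b) \<bullet> (?y - b) = (x - b) \<bullet> (x - b) + 2 * s * ((x - b) \<bullet> v) + s\<^sup>2 * (v \<bullet> v)"
        by (simp add: inner_diff_left inner_diff_right inner_add_left inner_add_right inner_commute power2_eq_square algebra_simps)
      also have "(x - a) \<bullet> (x - a) + 2 * s * ((x - a) \<bullet> v) + s\<^sup>2 * (v \<bullet> v)
          \<le> (x - b) \<bullet> (x - b) + 2 * s * ((x - b) \<bullet> v) + s\<^sup>2 * (v \<bullet> v) \<longleftrightarrow> (x - a) \<bullet> v \<le> (x - b) \<bullet> v"
        unfolding eq using s by simp
      also have "\<dots> \<longleftrightarrow> b \<bullet> v \<le> a \<bullet> v" by (simp add: inner_diff_left)
      finally show ?thesis .
    qed
    obtain a0 where a0: "a0 \<in> near A ?y" using near_nonempty[OF A] by blast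
    then have a0x: "a0 \<in> near A x" using sub by blast
    show ?thesis
    proof (intro equalityI subsetI CollectI conjI ballI)
      fix a assume a: "a \<in> near A ?y"
      show ax: "a \<in> near A x" using a sub by blast
      fix b assume b: "b \<in> near A x"
      then have "dist ?y a \<le> dist ?y b" using a near_subset unfolding near_iff[OF A(1)] by blast
      then show "b \<bullet> v \<le> a \<bullet> v" using cmp[OF ax b] by simp
    next
      fix a assume a: "a \<in> {a \<in> near A x. \<forall>b\<in>near A x. b \<bullet> v \<le> a \<bullet> v}"
      then have "dist ?y a \<le> dist ?y a0" using cmp[of a a0] a0x by simp
      moreover have "dist ?y a0 \<le> dist ?y b" if "b \<in> A" for b using a0 that unfolding near_iff[OF A(1)] by blast
      moreover have "a \<in> A" using a near_subset by blast
      ultimately show "a \<in> near A ?y" unfolding near_iff[OF A(1)] by (meson order_trans)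
    qed
  qed
  moreover have "d > 0" unfolding d_def using e(1) nv by simp
  ultimately show ?thesis by blast
qed

locale two_finite_sets =
  fixes A B :: "'a::euclidean_space set" and l :: real
  assumes A: "finite A" "A \<noteq> {}" and B: "finite B" "B \<noteq> {}"
begin

definition combinations :: "'a set" where
  "combinations = (\<lambda>(a, b). l *\<^sub>R a + (1 - l) *\<^sub>R b) ` (A \<times> B)"

lemma finite_combinations: "finite combinations"
  unfolding combinations_def using A B by simp

lemma near_pairs_subset: "near_pairs A B l x \<subseteq> combinations"
  unfolding near_pairs_def combinations_def using near_subset by fast

lemma near_pairs_nonempty: "near_pairs A B l x \<noteq> {}"
  unfolding near_pairs_def using near_nonempty[OF A] near_nonempty[OF B] by auto

text \<open>Fixing a nearest pair of \<open>y\<close> bounds the potential from above by a quadratic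
  that touches it at \<open>y\<close> and so dictates the gradient. Nonnegative weights enter here:
  for \<open>l > 1\<close> the inequality for the \<open>B\<close> term is reversed.\<close>

lemma gderiv_mixed_potential_unique:
  assumes l: "0 \<le> l" "l \<le> 1" and v: "GDERIV (mixed_potential A B l) y :> v" and p: "p \<in> near_pairs A B l y"
  shows "v = 2 *\<^sub>R (y - p)"
proof -
  obtain a b where ab: "a \<in> near A y" "b \<in> near B y" "p = l *\<^sub>R a + (1 - l) *\<^sub>R b"
    using p unfolding near_pairs_iff by blast
  define c where "c = l * (1 - l) * (norm (a - b))\<^sup>2"
  have "mixed_potential A B l z \<le> (norm (z - p))\<^sup>2 + c" for z
  proof -
    have "a \<in> A" "b \<in> B" using ab near_subset by blast+
    then have "(infdist z A)\<^sup>2 \<le> (norm (z - a))\<^sup>2" "(infdist z B)\<^sup>2 \<le> (norm (z - b))\<^sup>2"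
      by (auto intro!: power_mono infdist_nonneg infdist_le simp flip: dist_norm)
    then have "mixed_potential A B l z \<le> l * (norm (z - a))\<^sup>2 + (1 - l) * (norm (z - b))\<^sup>2"
      unfolding mixed_potential_def using l by (intro add_mono mult_left_mono) auto
    also have "\<dots> = (norm (z - p))\<^sup>2 + c" unfolding ab(3) c_def
      by (simp add: power2_norm_eq_inner inner_diff_left inner_diff_right inner_add_left inner_add_right
        inner_commute algebra_simps)
    finally show ?thesis .
  qed
  moreover have "mixed_potential A B l y = (norm (y - p))\<^sup>2 + c"
    unfolding c_def ab(3) by (rule mixed_potential_nearest[OF ab(1,2)])
  ultimately show ?thesis by (rule gderiv_eq_if_touching[OF v gderiv_norm_sq])
qed

text \<open>Near \<open>y\<close> only pairs already nearest at \<open>y\<close> are active, so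
  there the potential is a single quadratic centred at \<open>p\<close>.\<close>

lemma gderiv_mixed_potential:
  assumes p: "near_pairs A B l y \<subseteq> {p}"
  shows "y \<in> grad_set (mixed_potential A B l) p"
proof -
  obtain e1 where e1: "e1 > 0" "\<And>z. z \<in> ball y e1 \<Longrightarrow> near A z \<subseteq> near A y" using near_locally_subset[OF A(1)] by blast
  obtain e2 where e2: "e2 > 0" "\<And>z. z \<in> ball y e2 \<Longrightarrow> near B z \<subseteq> near B y" using near_locally_subset[OF B(1)] by blast
  define c where "c = mixed_potential A B l y - (norm (y - p))\<^sup>2"
  have eq: "(norm (z - p))\<^sup>2 + c = mixed_potential A B l z" if z: "z \<in> ball y (min e1 e2)" for z
  proof -
    obtain a b where ab: "a \<in> near A z" "b \<in> near B z" using near_nonempty[OF A] near_nonempty[OF B] by blast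
    then have ab': "a \<in> near A y" "b \<in> near B y" using e1(2)[of z] e2(2)[of z] z by auto
    then have "l *\<^sub>R a + (1 - l) *\<^sub>R b \<in> near_pairs A B l y" unfolding near_pairs_iff by blast
    then have "l *\<^sub>R a + (1 - l) *\<^sub>R b = p" using p by blast
    \<comment> \<open>Several pairs may give the same \<open>p\<close>; evaluation at
      \<open>y\<close> shows that their constants all equal \<open>c\<close>.\<close>
    then show ?thesis using mixed_potential_nearest[OF ab, of l] mixed_potential_nearest[OF ab', of l] unfolding c_def by simp
  qed
  have "((\<lambda>z. (norm (z - p))\<^sup>2 + c) has_derivative (\<lambda>h. h \<bullet> (2 *\<^sub>R (y - p)))) (at y)"
    using gderiv_norm_sq unfolding gderiv_def .
  then have "(mixed_potential A B l has_derivative (\<lambda>h. h \<bullet> (2 *\<^sub>R (y - p)))) (at y)"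
    by (rule has_derivative_transform_within_open[of _ _ _ _ "ball y (min e1 e2)"]) (use e1(1) e2(1) eq in auto)
  then show ?thesis unfolding grad_set_def gderiv_def by simp
qed

lemma grad_set_closure_subset:
  assumes l: "0 \<le> l" "l \<le> 1" and x: "x \<in> closure (grad_set (mixed_potential A B l) p)"
  shows "p \<in> near_pairs A B l x"
proof -
  have "grad_set (mixed_potential A B l) p \<subseteq> {x. p \<in> near_pairs A B l x}"
  proof (intro subsetI CollectI)
    fix y assume y: "y \<in> grad_set (mixed_potential A B l) p"
    obtain q where q: "q \<in> near_pairs A B l y" using near_pairs_nonempty by blast
    have "2 *\<^sub>R (y - p) = 2 *\<^sub>R (y - q)"
      using gderiv_mixed_potential_unique[OF l _ q] y unfolding grad_set_def by blast
    then show "p \<in> near_pairs A B l y" using q by simp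
  qed
  then have "closure (grad_set (mixed_potential A B l) p) \<subseteq> {x. p \<in> near_pairs A B l x}"
    using closed_near_pairs[OF A(1) B(1)] by (rule closure_minimal)
  then show ?thesis using x by blast
qed

text \<open>Moving from \<open>x\<close> towards the farthest of the combined nearest points \<open>p\<close> makes \<open>p\<close> the only
  combined nearest point, because \<open>p\<close> is the unique maximiser of \<open>\<lambda>q. q \<bullet> (p - x)\<close> among them.\<close>

lemma segment_to_farthest:
  assumes l: "0 \<le> l" "l \<le> 1" and p: "p \<in> near_pairs A B l x"
    and far: "\<And>q. q \<in> near_pairs A B l x \<Longrightarrow> norm (q - x) \<le> norm (p - x)"
  shows "\<exists>d>0. \<forall>s\<in>{0<..d}. x + s *\<^sub>R (p - x) \<in> grad_set (mixed_potential A B l) p"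
proof -
  define v where "v = p - x"
  obtain d1 where d1: "d1 > 0" "\<And>s. s \<in> {0<..d1} \<Longrightarrow> near A (x + s *\<^sub>R v) = {a \<in> near A x. \<forall>b\<in>near A x. b \<bullet> v \<le> a \<bullet> v}"
    using near_direction[OF A] by blast
  obtain d2 where d2: "d2 > 0" "\<And>s. s \<in> {0<..d2} \<Longrightarrow> near B (x + s *\<^sub>R v) = {a \<in> near B x. \<forall>b\<in>near B x. b \<bullet> v \<le> a \<bullet> v}"
    using near_direction[OF B] by blast
  obtain a0 b0 where ab0: "a0 \<in> near A x" "b0 \<in> near B x" "p = l *\<^sub>R a0 + (1 - l) *\<^sub>R b0"
    using p unfolding near_pairs_iff by blast
  have "x + s *\<^sub>R v \<in> grad_set (mixed_potential A B l) p" if s: "s \<in> {0<..min d1 d2}" for s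
  proof (rule gderiv_mixed_potential, rule subsetI)
    fix q assume "q \<in> near_pairs A B l (x + s *\<^sub>R v)"
    then obtain a b where ab: "a \<in> near A (x + s *\<^sub>R v)" "b \<in> near B (x + s *\<^sub>R v)" "q = l *\<^sub>R a + (1 - l) *\<^sub>R b"
      unfolding near_pairs_iff by blast
    have a: "a \<in> near A x" "a0 \<bullet> v \<le> a \<bullet> v" using ab(1) ab0(1) d1(2)[of s] s by auto
    have b: "b \<in> near B x" "b0 \<bullet> v \<le> b \<bullet> v" using ab(2) ab0(2) d2(2)[of s] s by auto
    have "p \<bullet> v \<le> q \<bullet> v" unfolding ab0(3) ab(3) inner_add_left inner_scaleR_left
      using a(2) b(2) l by (intro add_mono mult_left_mono) auto
    moreover have "q \<in> near_pairs A B l x" unfolding near_pairs_iff using a(1) b(1) ab(3) by blast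
    then have "norm (q - x) \<le> norm (p - x)" by (rule far)
    then have "(q - x) \<bullet> (q - x) \<le> v \<bullet> v" unfolding v_def by (simp add: norm_le)
    \<comment> \<open>As \<open>(q - p) \<bullet> v\<close> is nonnegative and \<open>q\<close> is
      no farther from \<open>x\<close> than \<open>p\<close>, this expansion leaves only
      \<open>q = p\<close>.\<close>
    moreover have "(q - x) \<bullet> (q - x) = v \<bullet> v + 2 * ((q - p) \<bullet> v) + (q - p) \<bullet> (q - p)"
    proof -
      have eq: "q - x = v + (q - p)" unfolding v_def by simp
      show ?thesis unfolding eq by (simp add: inner_add_left inner_add_right inner_commute)
    qed
    ultimately have "(q - p) \<bullet> (q - p) \<le> 0" by (simp add: inner_diff_left)
    then show "q \<in> {p}" by (simp add: inner_gt_zero_iff flip: not_less)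
  qed
  then show ?thesis unfolding v_def using d1(1) d2(1) by (intro exI[of _ "min d1 d2"]) auto
qed

lemma segment_closure:
  assumes "d > 0" and "\<And>s. s \<in> {0<..d} \<Longrightarrow> x + s *\<^sub>R v \<in> (V::'a set)" and "s \<in> {0..d}"
  shows "x + s *\<^sub>R v \<in> closure V"
proof (cases "s = 0")
  case False
  then have "s \<in> {0<..d}" using assms(3) by simp
  then have "x + s *\<^sub>R v \<in> V" by (rule assms(2))
  then show ?thesis using closure_subset by blast
next
  case True
  have "(\<lambda>n::nat. x + (d / Suc n) *\<^sub>R v) \<longlonglongrightarrow> x + 0 *\<^sub>R v"
    by (intro tendsto_intros LIMSEQ_Suc lim_const_over_n)
  moreover have "x + (d / Suc n) *\<^sub>R v \<in> V" for n :: nat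
    using assms(1) by (intro assms(2)) (auto simp: field_simps)
  ultimately show ?thesis
    unfolding closure_sequential True by (intro exI[of _ "\<lambda>n. x + (d / Suc n) *\<^sub>R v"]) simp
qed

lemma clarke_mixed_potential:
  assumes l: "0 \<le> l" "l \<le> 1"
  shows "clarke_subdifferential (mixed_potential A B l) x =
    (\<lambda>p. 2 *\<^sub>R (x - p)) ` (convex hull {p \<in> combinations. x \<in> closure (grad_set (mixed_potential A B l) p)})"
proof (rule clarke_subdifferential_finite_gradients[OF finite_combinations])
  fix y v assume v: "GDERIV (mixed_potential A B l) y :> v"
  obtain p where p: "p \<in> near_pairs A B l y" using near_pairs_nonempty by blast
  then show "\<exists>p\<in>combinations. v = 2 *\<^sub>R (y - p)"
    using gderiv_mixed_potential_unique[OF l v p] near_pairs_subset by blast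
qed

end

text \<open>The squared distance is the mixed potential with equal sets and \<open>l = 1\<close>.
  All nearest points of \<open>x\<close> are equally far from \<open>x\<close>, so each is a
  farthest one and its gradient region reaches \<open>x\<close>.\<close>

lemma clarke_infdist_sq:
  fixes A :: "'a::euclidean_space set"
  assumes A: "finite A" "A \<noteq> {}"
  shows "clarke_subdifferential (\<lambda>y. (infdist y A)\<^sup>2) x = (\<lambda>p. 2 *\<^sub>R (x - p)) ` (convex hull near A x)"
proof -
  interpret two_finite_sets A A 1 by unfold_locales (use A in auto)
  have pairs: "near_pairs A A 1 z = near A z" for z by (rule near_pairs_1[OF A])
  have "{p \<in> combinations. x \<in> closure (grad_set (mixed_potential A A 1) p)} = near A x"
  proof (intro equalityI subsetI)
    fix p assume "p \<in> {p \<in> combinations. x \<in> closure (grad_set (mixed_potential A A 1) p)}"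
    then show "p \<in> near A x" using grad_set_closure_subset[of x p] unfolding pairs by simp
  next
    fix p assume p: "p \<in> near A x"
    have "norm (q - x) \<le> norm (p - x)" if "q \<in> near A x" for q
      using p that unfolding near_def by (simp add: dist_norm norm_minus_commute)
    then obtain d where d: "d > 0" "\<And>s. s \<in> {0<..d} \<Longrightarrow> x + s *\<^sub>R (p - x) \<in> grad_set (mixed_potential A A 1) p"
      using segment_to_farthest[of p x] p unfolding pairs by auto
    have "x \<in> closure (grad_set (mixed_potential A A 1) p)"
      using segment_closure[OF d(1) d(2), of 0] d(1) by simp
    moreover have "p \<in> combinations" using p near_pairs_subset[of x] unfolding pairs by blast
    ultimately show "p \<in> {p \<in> combinations. x \<in> closure (grad_set (mixed_potential A A 1) p)}" by simp
  qed
  then show ?thesis using clarke_mixed_potential[of x] unfolding mixed_potential_1 by simp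
qed

section \<open>The inner and the outer flow\<close>

lemma finite_has_maximiser:
  fixes g :: "'a \<Rightarrow> 'b::linorder"
  assumes "finite P" "P \<noteq> {}"
  shows "\<exists>p\<in>P. \<forall>q\<in>P. g q \<le> g p"
proof -
  have "Max (g ` P) \<in> g ` P" using assms by (intro Max_in) auto
  then obtain p where p: "p \<in> P" "Max (g ` P) = g p" by blast
  have "g q \<le> g p" if "q \<in> P" for q
    unfolding p(2)[symmetric] using assms(1) that by (intro Max_ge) auto
  then show ?thesis using p(1) by blast
qed

text \<open>\<open>q\<close> is a weighted mean whose value \<open>q \<bullet> v\<close> is at least
  that of every point of \<open>N\<close>, so the weights vanish at points with smaller
  value.\<close>

lemma convex_hull_maximal_face:
  fixes N :: "'a::euclidean_space set"
  assumes N: "finite N" and q: "q \<in> convex hull N" and max: "\<And>b. b \<in> N \<Longrightarrow> b \<bullet> v \<le> q \<bullet> v"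
  shows "q \<in> convex hull {b \<in> N. \<forall>c\<in>N. c \<bullet> v \<le> b \<bullet> v}"
proof -
  obtain u where u: "\<And>b. b \<in> N \<Longrightarrow> 0 \<le> u b" "sum u N = 1" "(\<Sum>b\<in>N. u b *\<^sub>R b) = q"
    using q unfolding convex_hull_finite[OF N] by blast
  define N' where "N' = {b \<in> N. b \<bullet> v = q \<bullet> v}"
  have "(\<Sum>b\<in>N. u b * (q \<bullet> v - b \<bullet> v)) = sum u N * (q \<bullet> v) - (\<Sum>b\<in>N. u b *\<^sub>R b) \<bullet> v"
    by (simp add: right_diff_distrib sum_subtractf sum_distrib_right inner_sum_left)
  also have "\<dots> = 0" unfolding u(2,3) by simp
  finally have "(\<Sum>b\<in>N. u b * (q \<bullet> v - b \<bullet> v)) = 0" .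
  moreover have "0 \<le> u b * (q \<bullet> v - b \<bullet> v)" if "b \<in> N" for b
    using u(1)[OF that] max[OF that] by simp
  ultimately have zero: "u b * (q \<bullet> v - b \<bullet> v) = 0" if "b \<in> N" for b
    using sum_nonneg_eq_0_iff[OF N, of "\<lambda>b. u b * (q \<bullet> v - b \<bullet> v)"] that by blast
  then have u0: "u b = 0" if "b \<in> N - N'" for b using that unfolding N'_def by force
  have sub: "N' \<subseteq> N" unfolding N'_def by blast
  have "sum u N' = 1" using sum.mono_neutral_right[OF N sub, of u] u0 u(2) by auto
  moreover have "(\<Sum>b\<in>N'. u b *\<^sub>R b) = q"
    using sum.mono_neutral_right[OF N sub, of "\<lambda>b. u b *\<^sub>R b"] u0 u(3) by auto
  moreover have "\<forall>b\<in>N'. 0 \<le> u b" using u(1) sub by blast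
  ultimately have "q \<in> convex hull N'"
    unfolding convex_hull_finite[OF finite_subset[OF sub N]] by blast
  moreover have "N' \<subseteq> {b \<in> N. \<forall>c\<in>N. c \<bullet> v \<le> b \<bullet> v}" using max unfolding N'_def by auto
  ultimately show ?thesis using hull_mono by blast
qed

context two_finite_sets
begin

text \<open>The two hulls are taken independently, which matches the Minkowski sum of the outer
  subdifferential; for the inner flow this set serves as an upper bound.\<close>

definition combined_hull :: "'a \<Rightarrow> 'a set" where
  "combined_hull x = {l *\<^sub>R p + (1 - l) *\<^sub>R q | p q. p \<in> convex hull near A x \<and> q \<in> convex hull near B x}"

lemma combined_hull_image:
  "combined_hull x = (\<lambda>(p, q). l *\<^sub>R p + (1 - l) *\<^sub>R q) ` ((convex hull near A x) \<times> (convex hull near B x))"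
  unfolding combined_hull_def by auto

lemma convex_combined_hull: "convex (combined_hull x)"
proof -
  have "linear (\<lambda>(p, q). l *\<^sub>R p + (1 - l) *\<^sub>R q :: 'a)"
    by (rule linearI) (auto simp: algebra_simps)
  then show ?thesis
    unfolding combined_hull_image by (intro convex_linear_image convex_Times convex_convex_hull)
qed

lemma closed_combined_hull: "closed (combined_hull x)"
proof -
  have "compact (convex hull near A x)" "compact (convex hull near B x)"
    using A B by (auto intro!: finite_imp_compact_convex_hull finite_near)
  then show ?thesis unfolding combined_hull_image case_prod_beta
    by (intro compact_imp_closed compact_continuous_image compact_Times continuous_intros)
qed

lemma near_pairs_subset_combined_hull: "near_pairs A B l x \<subseteq> combined_hull x"
  unfolding combined_hull_image near_pairs_def by (intro image_mono Sigma_mono hull_subset)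

text \<open>Upper semicontinuity holds because closures of finitely many gradient regions are
  involved. For the segment property, the farthest combined nearest point keeps its region along the
  segment, and passing to the closure includes the starting point \<open>x\<close>.\<close>

lemma nearest_point_flow_inner:
  assumes l: "0 \<le> l" "l \<le> 1"
  shows "nearest_point_flow A B l
    (\<lambda>x. convex hull {p \<in> combinations. x \<in> closure (grad_set (mixed_potential A B l) p)})"
proof (unfold_locales, fold combined_hull_def)
  let ?C = "\<lambda>p. closure (grad_set (mixed_potential A B l) p)"
  fix x :: 'a
  show "closed (convex hull {p \<in> combinations. x \<in> ?C p})"
    using finite_combinations by (intro compact_imp_closed finite_imp_compact_convex_hull) simp
  show "\<exists>e>0. \<forall>y\<in>ball x e. convex hull {p \<in> combinations. y \<in> ?C p} \<subseteq> convex hull {p \<in> combinations. x \<in> ?C p}"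
    using finite_closed_family_locally_subset[OF finite_combinations closed_closure, of x "grad_set (mixed_potential A B l)"]
    by (meson hull_mono)
  show "convex hull {p \<in> combinations. x \<in> ?C p} \<subseteq> combined_hull x"
  proof (rule hull_minimal[where S = convex])
    show "convex (combined_hull x)" by (rule convex_combined_hull)
    show "{p \<in> combinations. x \<in> ?C p} \<subseteq> combined_hull x"
      using grad_set_closure_subset[OF l] near_pairs_subset_combined_hull by blast
  qed
  show "\<exists>p\<in>convex hull {p \<in> combinations. x \<in> ?C p}. \<exists>d>0. \<forall>s\<in>{0..d}. p \<in> convex hull {q \<in> combinations. x + s *\<^sub>R (p - x) \<in> ?C q}"
  proof -
    have fin: "finite (near_pairs A B l x)" using near_pairs_subset finite_combinations by (rule finite_subset)
    obtain p where p: "p \<in> near_pairs A B l x" "\<And>q. q \<in> near_pairs A B l x \<Longrightarrow> norm (q - x) \<le> norm (p - x)"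
      using finite_has_maximiser[OF fin near_pairs_nonempty, of "\<lambda>q. norm (q - x)"] by blast
    obtain d where d: "d > 0" "\<And>s. s \<in> {0<..d} \<Longrightarrow> x + s *\<^sub>R (p - x) \<in> grad_set (mixed_potential A B l) p"
      using segment_to_farthest[OF l p] by blast
    have pS: "p \<in> combinations" using p(1) near_pairs_subset by blast
    have mem: "p \<in> convex hull {q \<in> combinations. x + s *\<^sub>R (p - x) \<in> ?C q}" if "s \<in> {0..d}" for s
      using segment_closure[OF d that] pS by (intro hull_inc) simp
    have "p \<in> convex hull {q \<in> combinations. x \<in> ?C q}" using mem[of 0] d(1) by simp
    then show ?thesis using d(1) mem by blast
  qed
qed (use A B in auto)

text \<open>The direction of motion at \<open>x\<close> is found by a max-min: \<open>p\<close> maximises over the nearest points in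
  \<open>A\<close> the distance from \<open>l p - x\<close> to the convex set \<open>(l - 1) conv (near B x)\<close>, and \<open>(l - 1) q\<close> is the
  projection onto that set. With \<open>v = l p + (1 - l) q - x\<close>, the projection inequality says that \<open>q\<close>
  maximises \<open>\<lambda>b. b \<bullet> v\<close>, and the maximality of the distance says that \<open>p\<close> maximises \<open>\<lambda>a. a \<bullet> v\<close>; both
  stay selected along \<open>x + s v\<close>.\<close>

lemma nearest_point_flow_outer:
  assumes l: "1 < l"
  shows "nearest_point_flow A B l combined_hull"
proof (unfold_locales, fold combined_hull_def)
  fix x :: 'a
  show "closed (combined_hull x)" by (rule closed_combined_hull)
  show "\<exists>e>0. \<forall>y\<in>ball x e. combined_hull y \<subseteq> combined_hull x"
  proof -
    obtain e1 where e1: "e1 > 0" "\<And>z. z \<in> ball x e1 \<Longrightarrow> near A z \<subseteq> near A x" using near_locally_subset[OF A(1)] by blast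
    obtain e2 where e2: "e2 > 0" "\<And>z. z \<in> ball x e2 \<Longrightarrow> near B z \<subseteq> near B x" using near_locally_subset[OF B(1)] by blast
    have "combined_hull y \<subseteq> combined_hull x" if "y \<in> ball x (min e1 e2)" for y
    proof -
      have "convex hull near A y \<subseteq> convex hull near A x" "convex hull near B y \<subseteq> convex hull near B x"
        using that by (auto intro!: hull_mono e1(2) e2(2))
      then show ?thesis unfolding combined_hull_image by (intro image_mono Sigma_mono)
    qed
    then show ?thesis using e1(1) e2(1) by (intro exI[of _ "min e1 e2"]) auto
  qed
  show "\<exists>k\<in>combined_hull x. \<exists>d>0. \<forall>s\<in>{0..d}. k \<in> combined_hull (x + s *\<^sub>R (k - x))"
  proof -
    define C where "C = (\<lambda>q. (l - 1) *\<^sub>R q) ` (convex hull near B x)"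
    have C: "convex C" "closed C" "C \<noteq> {}"
    proof -
      show "convex C" unfolding C_def by (intro convex_scaling convex_convex_hull)
      have "compact (convex hull near B x)" using B by (intro finite_imp_compact_convex_hull finite_near)
      then show "closed C" unfolding C_def by (intro compact_imp_closed compact_scaling)
      show "C \<noteq> {}" unfolding C_def using near_nonempty[OF B] by simp
    qed
    define f where "f p = dist (l *\<^sub>R p - x) (closest_point C (l *\<^sub>R p - x))" for p
    have finA: "finite (near A x)" using A(1) by (rule finite_near)
    obtain p where p: "p \<in> near A x" "\<And>p'. p' \<in> near A x \<Longrightarrow> f p' \<le> f p"
      using finite_has_maximiser[OF finA near_nonempty[OF A], of f] by blast
    define c where "c = closest_point C (l *\<^sub>R p - x)"
    have cC: "c \<in> C" unfolding c_def using C by (intro closest_point_in_set)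
    then obtain q where q: "q \<in> convex hull near B x" "c = (l - 1) *\<^sub>R q" unfolding C_def by blast
    define k where "k = l *\<^sub>R p + (1 - l) *\<^sub>R q"
    define v where "v = k - x"
    have vc: "l *\<^sub>R p - x - c = v" unfolding v_def k_def q(2) by (simp add: algebra_simps)
    have dotC: "v \<bullet> (c' - c) \<le> 0" if "c' \<in> C" for c'
      using closest_point_dot[OF C(1,2) that, of "l *\<^sub>R p - x"] unfolding c_def[symmetric] vc .
    have qmax: "b \<bullet> v \<le> q \<bullet> v" if "b \<in> near B x" for b
    proof -
      have "(l - 1) *\<^sub>R b \<in> C" unfolding C_def using hull_inc[OF that] by blast
      from dotC[OF this] have "(l - 1) * (v \<bullet> (b - q)) \<le> 0"
        unfolding q(2) by (simp add: inner_diff_right right_diff_distrib)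
      then have "v \<bullet> (b - q) \<le> 0" using l by (simp add: mult_le_0_iff)
      then show ?thesis by (simp add: inner_diff_right inner_commute)
    qed
    have pmax: "p' \<bullet> v \<le> p \<bullet> v" if p': "p' \<in> near A x" for p'
    proof -
      define c' where "c' = closest_point C (l *\<^sub>R p' - x)"
      have c'C: "c' \<in> C" unfolding c'_def using C by (intro closest_point_in_set)
      \<comment> \<open>Maximality of the distance at \<open>p\<close> gives
        \<open>|v + w| \<le> |v|\<close>, hence \<open>v \<bullet> w \<le> 0\<close>; the projection
        inequality at \<open>c\<close> takes care of the part \<open>c' - c\<close>.\<close>
      define w where "w = l *\<^sub>R (p' - p) - (c' - c)"
      have "l *\<^sub>R p' - x - c' = v + w" unfolding w_def vc[symmetric] by (simp add: algebra_simps)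
      moreover have "norm (l *\<^sub>R p' - x - c') \<le> norm v"
        using p(2)[OF p'] unfolding f_def c_def[symmetric] c'_def[symmetric] dist_norm vc .
      ultimately have "(v + w) \<bullet> (v + w) \<le> v \<bullet> v" by (simp add: norm_le)
      then have "2 * (v \<bullet> w) + w \<bullet> w \<le> 0" by (simp add: inner_add_left inner_add_right inner_commute)
      then have "v \<bullet> w \<le> 0" using inner_ge_zero[of w] by linarith
      then have "l * (v \<bullet> (p' - p)) \<le> 0" using dotC[OF c'C] unfolding w_def by (simp add: inner_diff_right)
      then have "v \<bullet> (p' - p) \<le> 0" using l by (simp add: mult_le_0_iff)
      then show ?thesis by (simp add: inner_diff_right inner_commute)
    qed
    obtain d1 where d1: "d1 > 0" "\<And>s. s \<in> {0<..d1} \<Longrightarrow> near A (x + s *\<^sub>R v) = {a \<in> near A x. \<forall>b\<in>near A x. b \<bullet> v \<le> a \<bullet> v}"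
      using near_direction[OF A] by blast
    obtain d2 where d2: "d2 > 0" "\<And>s. s \<in> {0<..d2} \<Longrightarrow> near B (x + s *\<^sub>R v) = {a \<in> near B x. \<forall>b\<in>near B x. b \<bullet> v \<le> a \<bullet> v}"
      using near_direction[OF B] by blast
    have k0: "k \<in> combined_hull x"
      unfolding combined_hull_def k_def using hull_inc[OF p(1)] q(1) by blast
    have "k \<in> combined_hull (x + s *\<^sub>R v)" if s: "s \<in> {0..min d1 d2}" for s
    proof (cases "s = 0")
      case True then show ?thesis using k0 by simp
    next
      case False
      then have s': "s \<in> {0<..d1}" "s \<in> {0<..d2}" using s by auto
      have "p \<in> near A (x + s *\<^sub>R v)" unfolding d1(2)[OF s'(1)] using p(1) pmax by blast
      then have "p \<in> convex hull near A (x + s *\<^sub>R v)" by (rule hull_inc)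
      \<comment> \<open>\<open>q\<close> need not itself be a nearest point; it survives as a
        combination of the maximising ones.\<close>
      moreover have "q \<in> convex hull near B (x + s *\<^sub>R v)" unfolding d2(2)[OF s'(2)]
        using B(1) q(1) qmax by (intro convex_hull_maximal_face finite_near)
      ultimately show ?thesis unfolding combined_hull_def k_def by blast
    qed
    then show ?thesis using k0 d1(1) d2(1) unfolding v_def
      by (intro bexI[of _ k] exI[of _ "min d1 d2"]) auto
  qed
qed (use A B in auto)

end

section \<open>From the abstract flow to the two differential inclusions\<close>

context nearest_point_flow
begin

text \<open>\<open>P\<close> stands for membership in whichever critical set belongs to the
  flow.\<close>

lemma dynamics:
  assumes P: "\<And>x. x \<in> K x \<Longrightarrow> P x"
  shows "(\<exists>Z. caratheodory_solution F z0 Z) \<and>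
    (\<forall>Z. caratheodory_solution F z0 Z \<longrightarrow>
       (\<forall>a b. 0 \<le> a \<and> a < b \<longrightarrow>
          set_integrable lebesgue {a..b} (\<lambda>\<tau>. (norm (vector_derivative Z (at \<tau>)))\<^sup>2) \<and>
          Phi (Z b) - Phi (Z a) =
            - 4 * (LINT \<tau>:{a..b}|lebesgue. (norm (vector_derivative Z (at \<tau>)))\<^sup>2)) \<and>
       antimono_on {0..} (\<lambda>\<tau>. Phi (Z \<tau>)) \<and>
       (\<exists>x. (Z \<longlongrightarrow> x) at_top \<and> P x))"
proof (intro conjI allI impI)
  show "\<exists>Z. caratheodory_solution F z0 Z" by (rule solution_exists)
next
  fix Z and a b :: real assume sol: "caratheodory_solution F z0 Z" and ab: "0 \<le> a \<and> a < b"
  let ?g = "\<lambda>\<tau>. (norm (vector_derivative Z (at \<tau>)))\<^sup>2"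
  have e: "(?g has_integral (Phi (Z a) - Phi (Z b)) / 4) {a..b}"
    using solution_properties(1)[OF sol, of a b] ab by simp
  \<comment> \<open>For a nonnegative integrand gauge integrability already gives Lebesgue
    integrability.\<close>
  have "?g absolutely_integrable_on {a..b}"
    using e by (intro nonnegative_absolutely_integrable_1) auto
  then show "set_integrable lebesgue {a..b} ?g" .
  then have "(LINT \<tau>:{a..b}|lebesgue. ?g \<tau>) = (Phi (Z a) - Phi (Z b)) / 4"
    using set_lebesgue_integral_eq_integral(2) integral_unique[OF e] by metis
  then show "Phi (Z b) - Phi (Z a) = - 4 * (LINT \<tau>:{a..b}|lebesgue. ?g \<tau>)" by simp
next
  fix Z assume sol: "caratheodory_solution F z0 Z"
  show "antimono_on {0..} (\<lambda>\<tau>. Phi (Z \<tau>))"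
  proof (rule monotone_onI)
    fix a b :: real assume "a \<in> {0..}" "b \<in> {0..}" "a \<le> b"
    then show "Phi (Z b) \<le> Phi (Z a)"
      using has_integral_nonneg[OF solution_properties(1)[OF sol, of a b]] by simp
  qed
  show "\<exists>x. (Z \<longlongrightarrow> x) at_top \<and> P x" using solution_properties(2)[OF sol] P by blast
qed

end

lemma measure_support_finite_dirac_mixture:
  assumes "finite_dirac_mixture u"
  shows "finite (measure_support u)" "measure_support u \<noteq> {}"
proof -
  obtain n w a where m: "is_dirac_mixture u n w a" using assms unfolding finite_dirac_mixture_def by blast
  then have "n \<ge> 1" unfolding is_dirac_mixture_def by blast
  then show "finite (measure_support u)" "measure_support u \<noteq> {}"
    unfolding measure_support_dirac_mixture[OF m] by auto
qed

theorem theorem3p16: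
  fixes u1 u2 :: "'a::euclidean_space measure" and l :: real and z0 :: 'a
  assumes "l \<ge> 0"
    and "finite_dirac_mixture u1" and "finite_dirac_mixture u2"
  shows "(\<exists>Z. caratheodory_solution (flow_field u1 u2 l) z0 Z) \<and>
    (\<forall>Z. caratheodory_solution (flow_field u1 u2 l) z0 Z \<longrightarrow>
       (\<forall>a b. 0 \<le> a \<and> a < b \<longrightarrow>
          set_integrable lebesgue {a..b} (\<lambda>\<tau>. (norm (vector_derivative Z (at \<tau>)))\<^sup>2) \<and>
          potential u1 u2 l (Z b) - potential u1 u2 l (Z a) =
            - 4 * (LINT \<tau>:{a..b}|lebesgue. (norm (vector_derivative Z (at \<tau>)))\<^sup>2)) \<and>
       antimono_on {0..} (\<lambda>\<tau>. potential u1 u2 l (Z \<tau>)) \<and>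
       (\<exists>x. (Z \<longlongrightarrow> x) at_top \<and>
            (l \<le> 1 \<longrightarrow> x \<in> Crit u1 u2 l) \<and>
            (l > 1 \<longrightarrow> x \<in> Crit_out u1 u2 l)))"
proof -
  define A where "A = measure_support u1"
  define B where "B = measure_support u2"
  have A: "finite A" "A \<noteq> {}" and B: "finite B" "B \<noteq> {}"
    unfolding A_def B_def using assms(2,3) by (simp_all add: measure_support_finite_dirac_mixture)
  interpret two_finite_sets A B l by unfold_locales (fact A B)+
  have pot: "potential u1 u2 l = mixed_potential A B l"
    by (simp add: fun_eq_iff potential_def mixed_potential_def A_def B_def)
  \<comment> \<open>The factor \<open>-1/4\<close> of the inclusion turns the gradient of the
    squared distance to \<open>p\<close> into the relaxation velocity towards
    \<open>p\<close>.\<close>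
  have speed: "- (1/4) *\<^sub>R (2 *\<^sub>R (x - p)) = (1/2) *\<^sub>R (p - x)" for x p :: 'a
    by (simp add: scaleR_diff_right)
  show ?thesis
  proof (cases "l \<le> 1")
    case True
    define K where "K x = convex hull {p \<in> combinations. x \<in> closure (grad_set (mixed_potential A B l) p)}" for x
    interpret nearest_point_flow A B l K
      unfolding K_def using nearest_point_flow_inner[OF assms(1) True] .
    have clarke: "clarke_subdifferential (potential u1 u2 l) x = (\<lambda>p. 2 *\<^sub>R (x - p)) ` K x" for x
      unfolding pot K_def by (rule clarke_mixed_potential[OF assms(1) True])
    have field: "flow_field u1 u2 l = F"
      unfolding fun_eq_iff flow_field_def if_P[OF True] clarke F_def image_image speed by simp
    have "(l \<le> 1 \<longrightarrow> x \<in> Crit u1 u2 l) \<and> (l > 1 \<longrightarrow> x \<in> Crit_out u1 u2 l)" if "x \<in> K x" for x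
    proof -
      have "0 = 2 *\<^sub>R (x - x)" by simp
      then have "x \<in> Crit u1 u2 l" unfolding Crit_def clarke using that by blast
      then show ?thesis using True by simp
    qed
    from dynamics[OF this] show ?thesis unfolding field pot .
  next
    case False
    then have l: "1 < l" by simp
    interpret nearest_point_flow A B l combined_hull by (rule nearest_point_flow_outer[OF l])
    have outer: "outer_subdifferential u1 u2 l x = (\<lambda>p. 2 *\<^sub>R (x - p)) ` combined_hull x" for x
    proof -
      \<comment> \<open>The weights \<open>l\<close> and \<open>1 - l\<close> add up to
        \<open>1\<close>, so the terms in \<open>x\<close> combine.\<close>
      have eq: "l *\<^sub>R (2 *\<^sub>R (x - p)) + (1 - l) *\<^sub>R (2 *\<^sub>R (x - q)) = 2 *\<^sub>R (x - (l *\<^sub>R p + (1 - l) *\<^sub>R q))" for p q :: 'a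
        by (simp add: algebra_simps)
      have "outer_subdifferential u1 u2 l x = {l *\<^sub>R v + (1 - l) *\<^sub>R w | v w.
          v \<in> (\<lambda>p. 2 *\<^sub>R (x - p)) ` (convex hull near A x) \<and> w \<in> (\<lambda>q. 2 *\<^sub>R (x - q)) ` (convex hull near B x)}"
        unfolding outer_subdifferential_def A_def[symmetric] B_def[symmetric]
          clarke_infdist_sq[OF A] clarke_infdist_sq[OF B] ..
      also have "\<dots> = (\<lambda>(p, q). l *\<^sub>R (2 *\<^sub>R (x - p)) + (1 - l) *\<^sub>R (2 *\<^sub>R (x - q))) `
          ((convex hull near A x) \<times> (convex hull near B x))"
        by (simp only: set_eq_iff image_iff mem_Collect_eq Bex_def split_paired_Ex mem_Sigma_iff prod.case) blast
      also have "\<dots> = (\<lambda>p. 2 *\<^sub>R (x - p)) ` combined_hull x"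
        unfolding combined_hull_image image_image eq case_prod_beta ..
      finally show ?thesis .
    qed
    have field: "flow_field u1 u2 l = F"
      unfolding fun_eq_iff flow_field_def if_not_P[OF False] outer F_def image_image speed by simp
    have "(l \<le> 1 \<longrightarrow> x \<in> Crit u1 u2 l) \<and> (l > 1 \<longrightarrow> x \<in> Crit_out u1 u2 l)"
      if "x \<in> combined_hull x" for x
    proof -
      have "0 = 2 *\<^sub>R (x - x)" by simp
      then have "x \<in> Crit_out u1 u2 l" unfolding Crit_out_def outer using that by blast
      then show ?thesis using l by simp
    qed
    from dynamics[OF this] show ?thesis unfolding field pot .
  qed
qed

end
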